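(* There exists a locally connected compact plane set $X$ such that $R(X)$ is essential, non-trivial and non-regular and yet $R(X)$ admits no non-trivial Jensen measures.
   Context: A compact plane set is a non-empty compact subset of $\mathbb{C}$. For a compact plane set $X$, $R(X)$ is the uniform closure in $C(X)$ of the set of restrictions to $X$ of rational functions with no poles on $X$. $R(X)$ is non-trivial if $R(X)\neq C(X)$. $R(X)$ is essential if there is no proper closed subset $E$ of $X$ such that $R(X)$ contains every $f\in C(X)$ with $f(y)=0$ for all $y\in E$. Every character of $R(X)$ is an evaluation $\varepsilon_x: f\mapsto f(x)$ for some $x\in X$; hence $R(X)$ is regular if and only if it is regular on $X$, i.e. for each closed set $E\subseteq X$ and each $x\in X\setminus E$ there exists $f\in R(X)$ with $f(x)=1$ and $f(E)\subseteq\{0\}$; non-regular means not regular. A Jensen measure for $\varepsilon_x$ (with respect to $R(X)$) is a (Borel) probability measure $\mu$ on $X$ such that $\log|f(x)|\leq\int_X\log|f|\,d\mu$ for all $f\in R(X)$, with the convention $\log 0=-\infty$. Such a $\mu$ is trivial if $\mu=\delta_x$, the point mass at $x$. $R(X)$ admits no non-trivial Jensen measures if, for every $x\in X$, the only Jensen measure for $\varepsilon_x$ is $\delta_x$. *)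

theory Defs
  imports "HOL-Probability.Probability" "HOL-Computational_Algebra.Polynomial"
begin

definition compact_plane_set :: "complex set \<Rightarrow> bool" where
  "compact_plane_set X \<longleftrightarrow> X \<noteq> {} \<and> compact X"

text \<open>
  A function on \<open>X\<close> is represented by a total function on the complex plane whose values off
  \<open>X\<close> are irrelevant: membership in each of the three sets below depends only on the
  restriction to \<open>X\<close>, so that equality of such sets is equality of the corresponding sets
  of functions on \<open>X\<close>.
\<close>

definition C_alg :: "complex set \<Rightarrow> (complex \<Rightarrow> complex) set" where
  "C_alg X = {f. continuous_on X f}"

text \<open>
  A rational function without poles on \<open>X\<close> has, in lowest terms, a denominator without
  zeros on \<open>X\<close>.
\<close>

definition rational_on :: "complex set \<Rightarrow> (complex \<Rightarrow> complex) set" where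
  "rational_on X = {f. \<exists>p q :: complex poly.
      \<forall>z\<in>X. poly q z \<noteq> 0 \<and> f z = poly p z / poly q z}"

definition R_alg :: "complex set \<Rightarrow> (complex \<Rightarrow> complex) set" where
  "R_alg X = {f \<in> C_alg X. \<forall>e>0. \<exists>r\<in>rational_on X. \<forall>z\<in>X. cmod (f z - r z) < e}"

definition R_nontrivial :: "complex set \<Rightarrow> bool" where
  "R_nontrivial X \<longleftrightarrow> R_alg X \<noteq> C_alg X"

definition R_essential :: "complex set \<Rightarrow> bool" where
  "R_essential X \<longleftrightarrow>
    \<not> (\<exists>E. closedin (top_of_set X) E \<and> E \<noteq> X \<and>
          {f \<in> C_alg X. \<forall>y\<in>E. f y = 0} \<subseteq> R_alg X)"

text \<open>
  Every character of \<open>R(X)\<close> is evaluation at a point of \<open>X\<close>, so the character space is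
  identified with \<open>X\<close> and regularity is regularity on \<open>X\<close>.
\<close>

definition R_regular :: "complex set \<Rightarrow> bool" where
  "R_regular X \<longleftrightarrow>
    (\<forall>E x. closedin (top_of_set X) E \<and> x \<in> X - E \<longrightarrow>
        (\<exists>f\<in>R_alg X. f x = 1 \<and> f ` E \<subseteq> {0}))"

definition elog :: "real \<Rightarrow> ereal" where
  "elog t = (if t = 0 then -\<infinity> else ereal (ln t))"

text \<open>
  Integral of an extended-real function as the integral of the positive part minus that of the
  negative part (\<^const>\<open>e2ennreal\<close> sends negative values to 0). For \<open>log |f|\<close> with \<open>f\<close>
  bounded and a finite measure the positive part has finite integral, so the difference is well
  defined; it is \<open>-\<infinity>\<close> exactly when the negative part has infinite integral.
\<close>

definition ereal_integral :: "'a measure \<Rightarrow> ('a \<Rightarrow> ereal) \<Rightarrow> ereal" where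
  "ereal_integral M g =
    enn2ereal (\<integral>\<^sup>+ x. e2ennreal (g x) \<partial>M) - enn2ereal (\<integral>\<^sup>+ x. e2ennreal (- g x) \<partial>M)"

definition jensen_measure :: "complex set \<Rightarrow> complex \<Rightarrow> complex measure \<Rightarrow> bool" where
  "jensen_measure X x \<mu> \<longleftrightarrow>
    prob_space \<mu> \<and> space \<mu> = X \<and> sets \<mu> = sets (restrict_space borel X) \<and>
    (\<forall>f\<in>R_alg X. elog (cmod (f x)) \<le> ereal_integral \<mu> (\<lambda>y. elog (cmod (f y))))"

definition no_nontrivial_jensen :: "complex set \<Rightarrow> bool" where
  "no_nontrivial_jensen X \<longleftrightarrow>
    (\<forall>x\<in>X. \<forall>\<mu>. jensen_measure X x \<mu> \<longrightarrow> \<mu> = return (restrict_space borel X) x)"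

end

(*
  Take the disc of radius 2 and a countable family of circles avoiding the segment I = [0,1] that
  contains arbitrarily small circles around every other interior point.  At stage m, remove tiny
  discs, of radius about rho = exp (- N/(m+1)), around N = N(m) equidistributed points of one of these
  circles, every circle being used infinitely often.  With w = (z - q)/s, the function 1/(1 - w^N)
  is then bounded on X by 4/rho = exp(o(N)), has size about 1 inside the circle and is exponentially
  small in N outside it, so Jensen's inequality forces every Jensen measure of a point inside the
  circle to give mass 0 to the outside; 1 - 1/(1 - w^N) does the reverse.  Hence a Jensen measure of
  a point of X off I is trivial, and one of a point of I is carried by I, where a quadratic
  polynomial peaks.

  R(X) is not regular because a function in R(X) vanishing on [0,1/2] vanishes at 1: by Cauchy's formula
  it is on I the sum of a function holomorphic in a neighbourhood of I, involving only the first n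
  stages, and of an error as small as we please compared with that neighbourhood.  Montel's theorem
  and the identity theorem then give a bound at 1 that tends to 0 with n.

  Generic radii make any two discs nested or disjoint, so X is a disc minus disjoint discs of
  finite total radius; this gives local connectedness, and essentiality through the
  annihilating measure dz on the boundary circles.
*)

theory Submission
  imports Defs "HOL-Complex_Analysis.Complex_Analysis" "HOL-Real_Asymp.Real_Asymp"
begin

section \<open>Removing disjoint discs\<close>

text \<open>Two demands pull in opposite directions: failure of regularity needs late stages of tiny
  total radius, while Jensen's inequality needs functions whose poles are so close to the set to
  stay under control. They are compatible because Jensen's inequality sees logarithms only. For
  fixed m the product \<open>N * exp (- N / (m + 1))\<close> is as small as desired once N is large,
  whereas log (1 / \<rho>) = N / (m + 1) is, for large m, negligible against the decay exponent N *
  ln T away from the circle. One circle therefore has to return at arbitrarily late stages. The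
  order of choices is the other obstacle. Smallness of a stage is measured by constants that a
  compactness argument yields without a formula and that depend on the distances of earlier circles
  from the segment. So all circles are fixed first, then these constants, then the numbers N one
  after the other; the exact radii come last, because each must avoid values determined by the
  centres of all later stages.\<close>

lemma connected_Diff_ball:
  fixes K :: "'a::euclidean_space set"
  assumes "2 \<le> DIM('a)" "connected K" "closed K" "cball c r \<subseteq> K"
  shows "connected (K - ball c r)"
proof -
  \<comment> \<open>If the sphere misses B, so does the whole closed ball, which can then be added
    to A; this would split K itself.\<close>
  have no_split: False if AB: "closed A" "closed B" "A \<noteq> {}" "B \<noteq> {}" "A \<union> B = K - ball c r" "A \<inter> B = {}"
      "sphere c r \<inter> B = {}" for A B
  proof -
    have "B \<inter> cball c r = {}"
      using AB(5,7) by (auto simp: sphere_def ball_def cball_def)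
        (metis (mono_tags, lifting) DiffD2 Int_iff Un_iff empty_iff mem_Collect_eq order_le_imp_less_or_eq)
    moreover have "K = (A \<union> cball c r) \<union> B" using AB(5) assms(4) by (auto intro: less_imp_le)
    ultimately show False
      using connected_as_closed_union[OF assms(2), of "A \<union> cball c r" B] AB by auto
  qed
  \<comment> \<open>In dimension at least 2 the sphere is connected, so it lies on one side of any
    splitting.\<close>
  have "sphere c r \<inter> A = {} \<or> sphere c r \<inter> B = {}"
    if "closed A" "closed B" "A \<union> B = K - ball c r" "A \<inter> B = {}" for A B
  proof (rule ccontr)
    assume *: "\<not> ?thesis"
    have "sphere c r = (sphere c r \<inter> A) \<union> (sphere c r \<inter> B)"
      using that(3) assms(4) sphere_cball[of c r] by (force simp: set_eq_iff)
    then show False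
      using connected_as_closed_union[OF connected_sphere[OF assms(1)]] * that
      by (smt (verit) Int_assoc Int_commute closed_Int closed_sphere inf_bot_right)
  qed
  moreover have "closed (K - ball c r)" using assms(3) by auto
  ultimately show ?thesis
    unfolding connected_closed_set[OF \<open>closed (K - ball c r)\<close>]
    by (metis Int_commute Un_commute no_split)
qed

text \<open>Radial projection from c pushes the punctured ball onto the sphere. Since
  \<open>S - {c}\<close> is open in S and retracts inherit local connectedness, a disc can be
  removed from S without losing that property.\<close>

lemma retract_of_Diff_ball:
  fixes S :: "'a::euclidean_space set"
  assumes "cball c r \<subseteq> S" "0 < r"
  shows "(S - ball c r) retract_of (S - {c})"
proof -
  define h where "h z = c + max 1 (r / norm (z - c)) *\<^sub>R (z - c)" for z
  have far: "h z = z" if "r \<le> norm (z - c)" "z \<noteq> c" for z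
    using that assms(2) by (simp add: h_def max_def divide_le_eq_1)
  have near: "norm (h z - c) = r" if "norm (z - c) < r" "z \<noteq> c" for z
  proof -
    have "h z - c = (r / norm (z - c)) *\<^sub>R (z - c)"
      using that assms(2) by (simp add: h_def max_def divide_le_eq_1)
    then show ?thesis using that assms(2) by (simp del: scaleR_diff_right)
  qed
  have "continuous_on (S - {c}) h"
    unfolding h_def by (intro continuous_intros) auto
  moreover have "h z \<in> S - ball c r" if "z \<in> S - {c}" for z
  proof (cases "r \<le> norm (z - c)")
    case True
    then show ?thesis using far that by (auto simp: dist_norm norm_minus_commute)
  next
    case False
    then have "norm (h z - c) = r" using near that by auto
    then show ?thesis using assms(1) by (auto simp: dist_norm norm_minus_commute)
  qed
  moreover have "h z = z" if "z \<in> S - ball c r" for z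
    using that far[of z] assms(2) by (cases "z = c") (auto simp: dist_norm norm_minus_commute)
  moreover have "S - ball c r \<subseteq> S - {c}" using assms(2) by auto
  ultimately show ?thesis
    unfolding retract_of_def retraction_def by blast
qed

text \<open>Property S of Sierpinski.\<close>

lemma locally_connected_if_finite_small_covers:
  fixes X :: "'a::metric_space set"
  assumes "\<And>e. 0 < e \<Longrightarrow> \<exists>\<P>. finite \<P> \<and> X = \<Union>\<P> \<and>
     (\<forall>P\<in>\<P>. closed P \<and> connected P \<and> (\<forall>y\<in>P. \<forall>z\<in>P. dist y z < e))"
  shows "locally connected X"
proof -
  have "\<exists>u. openin (top_of_set X) u \<and> x \<in> u \<and> u \<subseteq> v \<and>
        (\<forall>y. y \<in> u \<longrightarrow> (\<exists>C. connected C \<and> C \<subseteq> v \<and> x \<in> C \<and> y \<in> C))"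
    if v: "openin (top_of_set X) v" "x \<in> v" for v x
  proof -
    obtain e where e: "e > 0" "ball x e \<inter> X \<subseteq> v" and "x \<in> X"
      using v by (metis openin_contains_ball openin_imp_subset subsetD)
    obtain \<P> where P: "finite \<P>" "X = \<Union>\<P>"
      "\<And>P. P \<in> \<P> \<Longrightarrow> closed P \<and> connected P \<and> (\<forall>y\<in>P. \<forall>z\<in>P. dist y z < e)"
      using assms[OF e(1)] by blast
    \<comment> \<open>Only finitely many closed pieces miss x, so u is a neighbourhood of x. It need
      not be connected, but each of its points shares a small connected piece with x, which is
      connectedness im kleinen.\<close>
    define u where "u = X - \<Union>{P\<in>\<P>. x \<notin> P}"
    have "closed (\<Union>{P\<in>\<P>. x \<notin> P})"
      using P by (intro closed_Union) auto
    then have "openin (top_of_set X) u"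
      unfolding u_def by (auto simp: openin_open Diff_eq intro!: exI[of _ "- \<Union>{P\<in>\<P>. x \<notin> P}"])
    moreover have "x \<in> u" using \<open>x \<in> X\<close> by (auto simp: u_def)
    moreover have *: "\<exists>C. connected C \<and> C \<subseteq> v \<and> x \<in> C \<and> y \<in> C" if "y \<in> u" for y
    proof -
      have "y \<in> \<Union>\<P>" using that P(2) unfolding u_def by blast
      then obtain C where "C \<in> \<P>" "y \<in> C" by blast
      moreover have "x \<in> C" using that \<open>C \<in> \<P>\<close> \<open>y \<in> C\<close> unfolding u_def by blast
      moreover have "C \<subseteq> v"
        using P(2) P(3)[OF \<open>C \<in> \<P>\<close>] \<open>x \<in> C\<close> \<open>C \<in> \<P>\<close> e(2) by (auto simp: subset_iff)
      ultimately show ?thesis using P(3) by blast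
    qed
    ultimately show ?thesis by blast
  qed
  then show ?thesis by (auto simp: locally_connected_im_kleinen)
qed

text \<open>The balls can accumulate only at P: each of them meets P, and only finitely many exceed
  a given radius.\<close>

lemma compact_Un_small_cballs:
  fixes P :: "'a::euclidean_space set"
  assumes "compact P" and small: "\<And>e. 0 < e \<Longrightarrow> finite {k\<in>B. e \<le> r k}"
    and meet: "\<And>k. k \<in> B \<Longrightarrow> cball (c k) (r k) \<inter> P \<noteq> {}"
  shows "compact (P \<union> (\<Union>k\<in>B. cball (c k) (r k)))" (is "compact ?K")
proof -
  have near: "\<exists>y\<in>P. dist y z \<le> 2 * r k" if "k \<in> B" "z \<in> cball (c k) (r k)" for k z
  proof -
    have "\<exists>y\<in>P. dist (c k) y \<le> r k" using meet[OF that(1)] by (auto simp: disjoint_iff)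
    then obtain y where "y \<in> P" "dist (c k) y \<le> r k" by blast
    then show ?thesis using that(2) dist_triangle3[of y z "c k"] by force
  qed
  have "bounded ?K"
  proof -
    obtain R where R: "\<And>y. y \<in> P \<Longrightarrow> norm y \<le> R" using compact_imp_bounded[OF assms(1)] unfolding bounded_iff by blast
    define M where "M = Max (insert 1 (r ` {k\<in>B. 1 \<le> r k}))"
    have M: "r k \<le> M" if "k \<in> B" for k
    proof (cases "1 \<le> r k")
      case True
      then show ?thesis unfolding M_def using that small[of 1] by (intro Max_ge) auto
    next
      case False
      moreover have "1 \<le> M" unfolding M_def using small[of 1] by (intro Max_ge) auto
      ultimately show ?thesis by linarith
    qed
    have "norm z \<le> R + 2 * M" if "k \<in> B" "z \<in> cball (c k) (r k)" for z k
    proof -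
      have "\<exists>y\<in>P. dist y z \<le> 2 * r k" using near[OF that] .
      then obtain y where "y \<in> P" "dist y z \<le> 2 * r k" by blast
      then have "norm z \<le> norm y + 2 * r k"
        using norm_triangle_sub[of z y] by (simp add: dist_norm norm_minus_commute)
      then show ?thesis using R[OF \<open>y \<in> P\<close>] M[OF that(1)] by linarith
    qed
    then have "\<forall>z\<in>(\<Union>k\<in>B. cball (c k) (r k)). norm z \<le> R + 2 * M" by blast
    then have "bounded (\<Union>k\<in>B. cball (c k) (r k))" unfolding bounded_iff ..
    then show ?thesis using compact_imp_bounded[OF assms(1)] by (rule bounded_Un[THEN iffD2, OF conjI, rotated])
  qed
  moreover have "closed ?K"
    unfolding closed_def open_contains_ball
  proof (rule ballI)
    fix z assume "z \<in> - ?K"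
    then have z: "z \<notin> ?K" by blast
    obtain d where d: "d > 0" "ball z d \<inter> P = {}"
      using z compact_imp_closed[OF assms(1)]
      by (metis Compl_iff UnI1 closed_def disjoint_eq_subset_Compl inf.commute openE)
    \<comment> \<open>A ball of radius below d/4 that meets P stays within d/2 of P, hence out of
      \<open>ball z (d/2)\<close>; only the finitely many larger balls need separate care.\<close>
    define F where "F = {k\<in>B. d / 4 \<le> r k}"
    have "finite F" unfolding F_def using small[of "d / 4"] d by simp
    then have "open (- (\<Union>k\<in>F. cball (c k) (r k)))"
      by (intro open_Compl closed_UN) auto
    moreover have "z \<in> - (\<Union>k\<in>F. cball (c k) (r k))" using z by (auto simp: F_def)
    ultimately obtain d' where d': "d' > 0" "ball z d' \<subseteq> - (\<Union>k\<in>F. cball (c k) (r k))"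
      by (meson openE)
    have "ball z (min d' (d/2)) \<subseteq> - ?K"
    proof
      fix w assume w: "w \<in> ball z (min d' (d/2))"
      have "w \<in> ball z d" using w d by auto
      then have "w \<notin> P" using d by blast
      moreover have "w \<notin> cball (c k) (r k)" if "k \<in> B" for k
      proof (cases "k \<in> F")
        case True then show ?thesis using w d' by auto
      next
        case False
        show ?thesis
        proof
          assume "w \<in> cball (c k) (r k)"
          then obtain y where y: "y \<in> P" "dist y w \<le> 2 * r k" using near[OF \<open>k \<in> B\<close>] by blast
          have "r k < d / 4" using False that by (auto simp: F_def)
          then have "dist z y < d" using y(2) w dist_triangle[of z y w] by (auto simp: dist_commute)
          then show False using d(2) y(1) by auto
        qed
      qed
      ultimately show "w \<in> - ?K" by auto
    qed
    moreover have "min d' (d/2) > 0" using d d' by auto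
    ultimately show "\<exists>e>0. ball z e \<subseteq> - ?K" by blast
  qed
  ultimately show ?thesis by (simp add: compact_eq_bounded_closed)
qed


section \<open>Swiss cheeses with disjoint closed discs of finite total radius:
  connectedness\<close>

locale disc_family =
  fixes A :: "'i set" and c :: "'i \<Rightarrow> complex" and r :: "'i \<Rightarrow> real"
  assumes r_pos: "k \<in> A \<Longrightarrow> 0 < r k"
    and inside: "k \<in> A \<Longrightarrow> cball (c k) (r k) \<subseteq> ball 0 2"
    and disj: "k \<in> A \<Longrightarrow> l \<in> A \<Longrightarrow> k \<noteq> l \<Longrightarrow> cball (c k) (r k) \<inter> cball (c l) (r l) = {}"
    and sum_r_le_1: "finite F \<Longrightarrow> F \<subseteq> A \<Longrightarrow> sum r F \<le> 1"
begin

definition cheese :: "complex set" where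
  "cheese = cball 0 2 - (\<Union>k\<in>A. ball (c k) (r k))"

lemma finite_large: "finite {k\<in>A. e \<le> r k}" if "0 < e"
proof (rule ccontr)
  assume "infinite {k\<in>A. e \<le> r k}"
  then obtain F where F: "F \<subseteq> {k\<in>A. e \<le> r k}" "finite F" "card F = nat \<lceil>1 / e\<rceil> + 1"
    using infinite_arbitrarily_large by blast
  have "real (card F) * e \<le> sum r F"
    using F(1) by (intro sum_bounded_below) auto
  also have "\<dots> \<le> 1" using F by (intro sum_r_le_1) auto
  finally have "real (card F) \<le> 1 / e" using that by (simp add: field_simps)
  then show False using F(3) by linarith
qed

text \<open>A finite F that nearly attains the supremum of all finite sums of radii leaves less than
  e for everything outside it. This replaces the tail of a convergent series over an unordered index
  set.\<close>

lemma finite_tail: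
  assumes "0 < e"
  obtains F where "finite F" "F \<subseteq> A" "\<And>G. finite G \<Longrightarrow> G \<subseteq> A - F \<Longrightarrow> sum r G < e"
proof -
  define S where "S = sum r ` {F. finite F \<and> F \<subseteq> A}"
  have S: "bdd_above S" "S \<noteq> {}" using sum_r_le_1 by (auto simp: S_def intro!: bdd_aboveI[of _ 1])
  then obtain F where F: "finite F" "F \<subseteq> A" "Sup S - e < sum r F"
    using assms less_cSup_iff[OF S(2,1), of "Sup S - e"] by (auto simp: S_def)
  have "sum r G < e" if "finite G" "G \<subseteq> A - F" for G
  proof -
    have "sum r F + sum r G = sum r (F \<union> G)"
      using that F by (subst sum.union_disjoint) auto
    also have "\<dots> \<le> Sup S" using that F S by (intro cSup_upper) (auto simp: S_def)
    finally show ?thesis using F(3) by linarith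
  qed
  with F that show ?thesis by blast
qed

lemma not_in_other_ball:
  "k \<in> A \<Longrightarrow> l \<in> A \<Longrightarrow> k \<noteq> l \<Longrightarrow> x \<in> cball (c k) (r k) \<Longrightarrow> x \<notin> ball (c l) (r l)"
  using disj[of k l] ball_subset_cball by blast

lemma sphere_subset_cheese:
  assumes "k \<in> A"
  shows "sphere (c k) (r k) \<subseteq> cheese"
proof
  fix x assume x: "x \<in> sphere (c k) (r k)"
  then have "x \<in> cball 0 2" using inside[OF assms] sphere_cball ball_subset_cball by blast
  moreover have "x \<notin> ball (c l) (r l)" if "l \<in> A" for l
    using not_in_other_ball[OF assms that, of x] x sphere_cball[of "c k" "r k"] by (cases "k = l") auto
  ultimately show "x \<in> cheese" by (auto simp: cheese_def)
qed

lemma outer_sphere_subset_cheese: "sphere 0 2 \<subseteq> cheese"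
proof
  fix x :: complex assume x: "x \<in> sphere 0 2"
  moreover have "x \<notin> ball (c l) (r l)" if "l \<in> A" for l
    using inside[OF that] x ball_subset_cball by fastforce
  ultimately show "x \<in> cheese" by (auto simp: cheese_def)
qed

lemma compact_cheese: "compact cheese"
  unfolding cheese_def by (intro compact_diff open_UN) auto

lemma locally_connected_Diff_finite:
  "finite F \<Longrightarrow> F \<subseteq> A \<Longrightarrow> locally connected (cball 0 2 - (\<Union>k\<in>F. ball (c k) (r k)))"
proof (induction rule: finite_induct)
  case empty
  then show ?case by (simp add: convex_imp_locally_connected)
next
  case (insert k F)
  define S where "S = cball 0 2 - (\<Union>k\<in>F. ball (c k) (r k))"
  have "cball (c k) (r k) \<subseteq> S"
  proof
    fix x assume x: "x \<in> cball (c k) (r k)"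
    have "x \<notin> ball (c l) (r l)" if "l \<in> F" for l
      using not_in_other_ball[of k l] that insert x by blast
    then show "x \<in> S" using inside[of k] insert x by (force simp: S_def)
  qed
  moreover have "locally connected (S - {c k})"
    by (rule locally_open_subset[of connected S]) (use insert in \<open>auto simp: S_def openin_delete\<close>)
  ultimately have "locally connected (S - ball (c k) (r k))"
    using retract_of_locally_connected retract_of_Diff_ball[of "c k" "r k" S] r_pos[of k] insert.prems by simp
  moreover have "S - ball (c k) (r k) = cball 0 2 - (\<Union>k\<in>insert k F. ball (c k) (r k))"
    by (auto simp: S_def)
  ultimately show ?case by simp
qed

lemma connected_Diff_finite:
  "finite F \<Longrightarrow> F \<subseteq> A \<Longrightarrow> compact K \<Longrightarrow> connected K \<Longrightarrow>
    (\<And>k. k \<in> F \<Longrightarrow> cball (c k) (r k) \<inter> K = {} \<or> cball (c k) (r k) \<subseteq> K) \<Longrightarrow>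
    connected (K - (\<Union>k\<in>F. ball (c k) (r k)))"
proof (induction rule: finite_induct)
  case empty
  then show ?case by simp
next
  case (insert k F)
  define S where "S = K - (\<Union>k\<in>F. ball (c k) (r k))"
  have S: "connected S" "closed S" using insert compact_imp_closed by (auto simp: S_def)
  have "connected (S - ball (c k) (r k))"
  proof (cases "cball (c k) (r k) \<subseteq> K")
    case True
    have "cball (c k) (r k) \<subseteq> S"
    proof
      fix x assume x: "x \<in> cball (c k) (r k)"
      have "x \<notin> ball (c l) (r l)" if "l \<in> F" for l
        using not_in_other_ball[of k l] that insert x by blast
      then show "x \<in> S" using True x by (force simp: S_def)
    qed
    then show ?thesis using connected_Diff_ball[OF _ S] by simp
  next
    case False
    then have "cball (c k) (r k) \<inter> K = {}" using insert by blast
    then have "S - ball (c k) (r k) = S" using ball_subset_cball by (force simp: S_def)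
    then show ?thesis using S by simp
  qed
  moreover have "S - ball (c k) (r k) = K - (\<Union>k\<in>insert k F. ball (c k) (r k))"
    by (auto simp: S_def)
  ultimately show ?case by simp
qed

text \<open>Remove the discs in order of size, radius at least 1/(n+1) at step n. Each step is a
  finite removal, and a decreasing intersection of compact connected sets is connected.\<close>

lemma connected_Diff_discs:
  assumes "B \<subseteq> A" "compact K" "connected K"
    and "\<And>k. k \<in> B \<Longrightarrow> cball (c k) (r k) \<inter> K = {} \<or> cball (c k) (r k) \<subseteq> K"
  shows "connected (K - (\<Union>k\<in>B. ball (c k) (r k)))"
proof -
  define F where "F n = {k\<in>B. 1 / (real n + 1) \<le> r k}" for n :: nat
  have F: "finite (F n)" "F n \<subseteq> B" for n
    using assms(1) finite_subset[OF _ finite_large[of "1 / (real n + 1)"], of "F n"] by (auto simp: F_def)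
  have mono: "F m \<subseteq> F n" if "m \<le> n" for m n
  proof -
    have "1 / (real n + 1) \<le> 1 / (real m + 1)" using that by (simp add: frac_le)
    then show ?thesis by (auto simp: F_def)
  qed
  have un: "(\<Union>n. F n) = B"
  proof -
    have "\<exists>n. 1 / (real n + 1) \<le> r k" if "k \<in> B" for k
      using reals_Archimedean[of "r k"] r_pos that assms(1)
      by (auto simp: inverse_eq_divide add.commute intro: less_imp_le)
    then show ?thesis by (auto simp: F_def)
  qed
  have "connected (\<Inter>n. K - (\<Union>k\<in>F n. ball (c k) (r k)))"
  proof (rule connected_nest)
    show "compact (K - (\<Union>k\<in>F n. ball (c k) (r k)))" for n
      using assms(2) by (intro compact_diff) auto
    show "connected (K - (\<Union>k\<in>F n. ball (c k) (r k)))" for n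
      using F assms by (intro connected_Diff_finite) blast+
  qed (use mono in blast)
  moreover have "(\<Inter>n. K - (\<Union>k\<in>F n. ball (c k) (r k))) = K - (\<Union>k\<in>B. ball (c k) (r k))"
    using un by blast
  ultimately show ?thesis by simp
qed

text \<open>Only the finitely many discs of radius at least d affect the picture at scale e. Without
  them the set is locally connected, so it has a finite cover by small connected sets; these are
  then adapted to the small discs before the latter are removed.\<close>

lemma locally_connected_cheese: "locally connected cheese"
proof (rule locally_connected_if_finite_small_covers)
  fix e :: real assume "0 < e"
  \<comment> \<open>A piece stays within \<open>3 * d\<close> of its centre, d for the neighbourhood
    and 2d for an absorbed disc, so its diameter is at most \<open>6 * d < e\<close>.\<close>
  define d where "d = e / 8"
  have d: "0 < d" using \<open>0 < e\<close> by (simp add: d_def)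
  define F where "F = {k\<in>A. d \<le> r k}"
  have F: "finite F" "F \<subseteq> A" using finite_large d by (auto simp: F_def)
  define S where "S = cball 0 2 - (\<Union>k\<in>F. ball (c k) (r k))"
  have S: "locally connected S" "compact S"
    using locally_connected_Diff_finite F by (auto simp: S_def intro!: compact_diff)
  have "\<exists>u. openin (top_of_set S) u \<and> connected u \<and> x \<in> u \<and> u \<subseteq> S \<inter> ball x d" if "x \<in> S" for x
    using S(1) that d unfolding locally_connected by (metis IntI centre_in_ball open_ball openin_open_Int)
  then obtain u where u: "\<And>x. x \<in> S \<Longrightarrow> openin (top_of_set S) (u x)"
    "\<And>x. x \<in> S \<Longrightarrow> connected (u x)" "\<And>x. x \<in> S \<Longrightarrow> x \<in> u x" "\<And>x. x \<in> S \<Longrightarrow> u x \<subseteq> S \<inter> ball x d"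
    by metis
  have "\<forall>U\<in>u ` S. openin (top_of_set S) U" "S \<subseteq> \<Union>(u ` S)" using u(1,3) by blast+
  then have "\<exists>T\<subseteq>u ` S. finite T \<and> S \<subseteq> \<Union>T"
    using S(2) unfolding compact_eq_openin_cover by simp
  then obtain T where T: "T \<subseteq> S" "finite T" "S \<subseteq> (\<Union>x\<in>T. u x)"
    by (metis finite_subset_image)
  \<comment> \<open>Absorbing every small disc that touches the closure leaves no disc half inside
    \<open>K x\<close>: each one lies in it or misses it, as \<open>connected_Diff_discs\<close>
    requires.\<close>
  define B where "B x = {k\<in>A - F. cball (c k) (r k) \<inter> closure (u x) \<noteq> {}}" for x
  define K where "K x = closure (u x) \<union> (\<Union>k\<in>B x. cball (c k) (r k))" for x
  define Q where "Q x = K x - (\<Union>k\<in>A-F. ball (c k) (r k))" for x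
  have cl: "closure (u x) \<subseteq> S \<inter> cball x d" if "x \<in> S" for x
    using u(4)[OF that] S(2) compact_imp_closed ball_subset_cball
    by (intro closure_minimal) (auto simp: subset_iff intro: less_imp_le)
  have cK: "compact (K x)" if "x \<in> S" for x
    unfolding K_def
  proof (rule compact_Un_small_cballs)
    show "compact (closure (u x))"
      using cl[OF that] S(2) by (meson bounded_subset compact_closure compact_imp_bounded closure_subset le_infE subset_trans)
    show "finite {k \<in> B x. e \<le> r k}" if "0 < e" for e
      using finite_large[OF that] by (rule rev_finite_subset) (auto simp: B_def)
  qed (auto simp: B_def)
  have conK: "connected (K x)" if "x \<in> S" for x
    unfolding K_def
    by (rule connected_Un_UN) (use u(2)[OF that] in \<open>auto simp: B_def Int_commute intro: connected_imp_connected_closure\<close>)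
  have "connected (Q x)" if "x \<in> S" for x
    unfolding Q_def
  proof (rule connected_Diff_discs)
    show "cball (c k) (r k) \<inter> K x = {} \<or> cball (c k) (r k) \<subseteq> K x" if "k \<in> A - F" for k
    proof (cases "k \<in> B x")
      case True
      then show ?thesis by (auto simp: K_def)
    next
      case False
      have "cball (c k) (r k) \<inter> cball (c l) (r l) = {}" if "l \<in> B x" for l
        using disj[of k l] \<open>k \<in> A - F\<close> that False by (auto simp: B_def)
      moreover have "cball (c k) (r k) \<inter> closure (u x) = {}" using False that by (auto simp: B_def)
      ultimately show ?thesis unfolding K_def by blast
    qed
  qed (use cK conK that in auto)
  moreover have "closed (Q x)" if "x \<in> S" for x
    using cK[OF that] unfolding Q_def by (intro closed_Diff compact_imp_closed) auto
  moreover have "dist y z < e" if "x \<in> S" "y \<in> Q x" "z \<in> Q x" for x y z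
  proof -
    have *: "dist x y \<le> 3 * d" if "y \<in> Q x" for y
    proof -
      have "y \<in> closure (u x) \<or> (\<exists>k\<in>B x. y \<in> cball (c k) (r k))"
        using that by (auto simp: Q_def K_def)
      then show ?thesis
      proof
        assume "y \<in> closure (u x)"
        then show ?thesis using cl[OF \<open>x \<in> S\<close>] d by force
      next
        assume "\<exists>k\<in>B x. y \<in> cball (c k) (r k)"
        then obtain k where k: "k \<in> B x" "dist (c k) y \<le> r k" by auto
        then have "\<exists>w\<in>closure (u x). dist (c k) w \<le> r k" by (auto simp: B_def disjoint_iff)
        then obtain w where w: "w \<in> closure (u x)" "dist (c k) w \<le> r k" by blast
        have "r k < d" using k by (auto simp: B_def F_def)
        moreover have "dist x w \<le> d" using cl[OF \<open>x \<in> S\<close>] w by force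
        moreover have "dist x y \<le> dist x w + dist (c k) w + dist (c k) y"
          by (metis add.assoc add_left_mono dist_commute dist_triangle dist_triangle_le order_trans)
        ultimately show ?thesis using k w by linarith
      qed
    qed
    have "dist y z \<le> dist x y + dist x z" by (metis dist_commute dist_triangle)
    also have "\<dots> \<le> 6 * d" using *[OF that(2)] *[OF that(3)] by linarith
    finally show ?thesis using \<open>0 < e\<close> by (simp add: d_def)
  qed
  moreover have "cheese = \<Union>(Q ` T)"
  proof
    show "cheese \<subseteq> \<Union>(Q ` T)"
    proof
      fix z assume z: "z \<in> cheese"
      then have "z \<in> S" using F by (auto simp: cheese_def S_def)
      then obtain x where "x \<in> T" "z \<in> u x" using T by auto
      then show "z \<in> \<Union>(Q ` T)"
        using z closure_subset[of "u x"] by (auto simp: Q_def K_def cheese_def)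
    qed
    have "K x \<subseteq> S" if "x \<in> S" for x
    proof -
      have "cball (c k) (r k) \<subseteq> S" if "k \<in> B x" for k
      proof
        fix y assume y: "y \<in> cball (c k) (r k)"
        have "y \<notin> ball (c l) (r l)" if "l \<in> F" for l
          using not_in_other_ball[of k l y] that \<open>k \<in> B x\<close> F y unfolding B_def by blast
        then show "y \<in> S" using inside[of k] that y by (force simp: S_def B_def)
      qed
      then show ?thesis using cl[OF that] by (auto simp: K_def)
    qed
    then show "\<Union>(Q ` T) \<subseteq> cheese"
      using T(1) unfolding Q_def S_def cheese_def by blast
  qed
  ultimately show "\<exists>\<P>. finite \<P> \<and> cheese = \<Union>\<P> \<and>
     (\<forall>P\<in>\<P>. closed P \<and> connected P \<and> (\<forall>y\<in>P. \<forall>z\<in>P. dist y z < e))"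
    using T by (intro exI[of _ "Q ` T"]) blast
qed

end

section \<open>Cauchy's theorem and essentiality\<close>

lemma rational_on_continuous: "g \<in> rational_on X \<Longrightarrow> continuous_on X g"
proof -
  assume "g \<in> rational_on X"
  then obtain p q where pq: "\<And>z. z \<in> X \<Longrightarrow> poly q z \<noteq> 0 \<and> g z = poly p z / poly q z"
    by (auto simp: rational_on_def)
  have "continuous_on X (\<lambda>z. poly p z / poly q z)"
    using pq by (intro continuous_intros) auto
  then show ?thesis using pq by (simp cong: continuous_on_cong)
qed

lemma rational_on_imp_R_alg: "g \<in> rational_on X \<Longrightarrow> g \<in> R_alg X"
  unfolding R_alg_def C_alg_def using rational_on_continuous by force

section \<open>The boundary cycle and Cauchy's formula for rational functions\<close>

context disc_family
begin

text \<open>Only finitely many removed circles enter at a time. For a given rational function those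
  that enclose its poles suffice, so the annihilating measure never has to be formed as an infinite
  sum.\<close>

definition boundary_integral :: "'i set \<Rightarrow> (complex \<Rightarrow> complex) \<Rightarrow> complex" where
  "boundary_integral F h = contour_integral (circlepath 0 2) h -
     (\<Sum>k\<in>F. contour_integral (circlepath (c k) (r k)) h)"

text \<open>The cycle winds once around z. Around a pole in a removed disc of F the outer circle
  contributes 1 and exactly one inner circle cancels it; around a pole of norm above 2 nothing
  winds. As z may be regular or singular, both Cauchy's theorem and Cauchy's formula are special
  cases.\<close>

lemma boundary_integral_eq_residue:
  assumes F: "finite F" "F \<subseteq> A" and P: "finite P" "h holomorphic_on - insert z P"
    and z: "norm z < 2" "\<And>k. k \<in> F \<Longrightarrow> z \<notin> cball (c k) (r k)"
    and poles: "\<And>p. p \<in> P \<Longrightarrow> 2 < norm p \<or> (\<exists>k\<in>F. p \<in> ball (c k) (r k))"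
  shows "boundary_integral F h = 2 * pi * \<i> * residue h z"
proof -
  define Q where "Q = insert z P"
  have Q: "finite Q" "h holomorphic_on UNIV - Q" using P by (auto simp: Q_def Compl_eq_Diff_UNIV)
  have outer: "contour_integral (circlepath 0 2) h = 2 * pi * \<i> * (\<Sum>p\<in>Q. winding_number (circlepath 0 2) p * residue h p)"
  proof (rule Residue_theorem[OF open_UNIV connected_UNIV Q])
    have "norm p \<noteq> 2" if "p \<in> Q" for p
    proof (cases "p = z")
      case False
      then have "2 < norm p \<or> (\<exists>k\<in>F. p \<in> ball (c k) (r k))" using poles that by (simp add: Q_def)
      moreover have "norm p < 2" if "k \<in> F" "p \<in> ball (c k) (r k)" for k
      proof -
        have "p \<in> ball 0 2" using inside[of k] F(2) that ball_subset_cball[of "c k" "r k"] by blast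
        then show ?thesis by simp
      qed
      ultimately show ?thesis by force
    qed (use z in auto)
    then show "path_image (circlepath 0 2) \<subseteq> UNIV - Q" by auto
  qed auto
  have inner: "contour_integral (circlepath (c k) (r k)) h =
      2 * pi * \<i> * (\<Sum>p\<in>Q. winding_number (circlepath (c k) (r k)) p * residue h p)" if "k \<in> F" for k
  proof (rule Residue_theorem[OF open_UNIV connected_UNIV Q])
    have k: "k \<in> A" using that F by auto
    have "p \<notin> sphere (c k) (r k)" if "p \<in> Q" for p
    proof
      assume p: "p \<in> sphere (c k) (r k)"
      then have "p \<in> cball (c k) (r k)" by auto
      then have "norm p < 2" "p \<noteq> z" using inside[OF k] z(2)[OF \<open>k \<in> F\<close>] by auto
      moreover have "p \<in> P" using that \<open>p \<noteq> z\<close> by (simp add: Q_def)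
      ultimately obtain l where "l \<in> F" "p \<in> ball (c l) (r l)" using poles by force
      then show False using not_in_other_ball[OF k, of l p] p F sphere_cball[of "c k" "r k"] by (cases "k = l") auto
    qed
    then show "path_image (circlepath (c k) (r k)) \<subseteq> UNIV - Q"
      using r_pos[OF k] by auto
  qed auto
  have wn_in: "winding_number (circlepath a s) p = 1" if "p \<in> ball a s" for a p :: complex and s
    using that by (intro winding_number_circlepath) (auto simp: dist_norm norm_minus_commute)
  have wn_out: "winding_number (circlepath a s) p = 0" if "p \<notin> cball a s" "0 < s" for a p :: complex and s
    using that sphere_cball[of a s] by (intro winding_number_zero_outside[where s="cball a s"]) auto
  define W where "W p = winding_number (circlepath 0 2) p - (\<Sum>k\<in>F. winding_number (circlepath (c k) (r k)) p)" for p
  have Wz: "W z = 1"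
  proof -
    have "(\<Sum>k\<in>F. winding_number (circlepath (c k) (r k)) z) = 0"
      using wn_out z(2) r_pos F by (intro sum.neutral) auto
    then show ?thesis using wn_in[of z 0 2] z by (simp add: W_def)
  qed
  have W0: "W p = 0" if "p \<in> P" for p
    using poles[OF that]
  proof
    assume p: "2 < norm p"
    have "p \<notin> cball (c k) (r k)" if "k \<in> F" for k
      using p inside that F by force
    then have "(\<Sum>k\<in>F. winding_number (circlepath (c k) (r k)) p) = 0"
      using wn_out r_pos F by (intro sum.neutral) auto
    then show ?thesis using wn_out[of p 0 2] p by (simp add: W_def)
  next
    assume "\<exists>k\<in>F. p \<in> ball (c k) (r k)"
    then obtain k where k: "k \<in> F" "p \<in> ball (c k) (r k)" by blast
    have "p \<notin> cball (c l) (r l)" if "l \<in> F - {k}" for l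
      using not_in_other_ball[of l k p] k that F by auto
    then have "(\<Sum>l\<in>F - {k}. winding_number (circlepath (c l) (r l)) p) = 0"
      by (intro sum.neutral ballI wn_out) (use r_pos F in auto)
    then have "(\<Sum>l\<in>F. winding_number (circlepath (c l) (r l)) p) = 1"
      using wn_in[OF k(2)] F k by (simp add: sum.remove)
    moreover have "p \<in> ball 0 2" using k inside[of k] F ball_subset_cball by blast
    ultimately show ?thesis using wn_in[of p 0 2] by (simp add: W_def)
  qed
  have "boundary_integral F h = 2 * pi * \<i> * (\<Sum>p\<in>Q. W p * residue h p)"
    unfolding boundary_integral_def outer
    by (subst sum.cong[OF refl inner], assumption)
       (simp add: W_def left_diff_distrib sum_subtractf right_diff_distrib sum_distrib_right
         flip: sum_distrib_left sum.swap[of _ F Q])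
  also have "(\<Sum>p\<in>Q. W p * residue h p) = residue h z"
  proof -
    have "(\<Sum>p\<in>Q. W p * residue h p) = (\<Sum>p\<in>Q. if p = z then residue h z else 0)"
      using Wz W0 by (intro sum.cong) (auto simp: Q_def)
    then show ?thesis using Q(1) by (simp add: Q_def)
  qed
  finally show ?thesis .
qed

lemma path_image_subset_cheese: "k \<in> A \<Longrightarrow> path_image (circlepath (c k) (r k)) \<subseteq> cheese"
  using sphere_subset_cheese r_pos by (simp add: less_imp_le)

lemma path_image_outer_subset_cheese: "path_image (circlepath 0 2) \<subseteq> cheese"
  using outer_sphere_subset_cheese by simp

lemma boundary_integral_cong:
  assumes "F \<subseteq> A" "\<And>w. w \<in> cheese \<Longrightarrow> f w = g w"
  shows "boundary_integral F f = boundary_integral F g"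
proof -
  have "contour_integral (circlepath (c k) (r k)) f = contour_integral (circlepath (c k) (r k)) g" if "k \<in> F" for k
    using assms path_image_subset_cheese[of k] that by (intro contour_integral_eq) blast
  moreover have "contour_integral (circlepath 0 2) f = contour_integral (circlepath 0 2) g"
    using assms path_image_outer_subset_cheese by (intro contour_integral_eq) blast
  ultimately show ?thesis by (simp add: boundary_integral_def)
qed

text \<open>One removed disc for each pole of norm at most 2 makes up F0. The conclusion is stated
  for every finite F above F0 because later arguments enlarge F by discs of their own.\<close>

lemma rational_cauchy:
  assumes g: "g \<in> rational_on cheese"
  obtains F0 where "finite F0" "F0 \<subseteq> A"
    "\<And>F z. finite F \<Longrightarrow> F0 \<subseteq> F \<Longrightarrow> F \<subseteq> A \<Longrightarrow> norm z < 2 \<Longrightarrow> (\<And>k. k \<in> A \<Longrightarrow> z \<notin> cball (c k) (r k)) \<Longrightarrow>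
      boundary_integral F g = 0 \<and> boundary_integral F (\<lambda>w. g w / (w - z)) = 2 * pi * \<i> * g z"
proof -
  obtain p q where pq: "\<And>z. z \<in> cheese \<Longrightarrow> poly q z \<noteq> 0" "\<And>z. z \<in> cheese \<Longrightarrow> g z = poly p z / poly q z"
    using g by (auto simp: rational_on_def)
  have "(2::complex) \<in> cheese" using outer_sphere_subset_cheese by auto
  then have "q \<noteq> 0" using pq(1) by force
  define P where "P = {z. poly q z = 0}"
  have P: "finite P" using poly_roots_finite[OF \<open>q \<noteq> 0\<close>] by (simp add: P_def)
  have "2 < norm u \<or> (\<exists>k\<in>A. u \<in> ball (c k) (r k))" if "u \<in> P" for u
  proof -
    have "u \<notin> cheese" using pq(1)[of u] that by (auto simp: P_def)
    then show ?thesis by (auto simp: cheese_def not_le)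
  qed
  then obtain k where k: "\<And>u. u \<in> P \<Longrightarrow> \<not> 2 < norm u \<Longrightarrow> k u \<in> A \<and> u \<in> ball (c (k u)) (r (k u))"
    by metis
  define F0 where "F0 = k ` {u\<in>P. \<not> 2 < norm u}"
  \<comment> \<open>The values of g off the set are arbitrary, so residues are taken for the
    quotient of polynomials and transferred to g along the circles.\<close>
  define G where "G w = poly p w / poly q w" for w
  have G: "G holomorphic_on - P" unfolding G_def by (intro holomorphic_intros) (auto simp: P_def)
  show ?thesis
  proof (rule that[of F0])
    fix F z assume F: "finite F" "F0 \<subseteq> F" "F \<subseteq> A" and z: "norm z < 2" "\<And>k. k \<in> A \<Longrightarrow> z \<notin> cball (c k) (r k)"
    have z': "z \<in> cheese" using z ball_subset_cball by (force simp: cheese_def)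
    then have "z \<notin> P" using pq(1) by (auto simp: P_def)
    have poles: "2 < norm u \<or> (\<exists>k\<in>F. u \<in> ball (c k) (r k))" if "u \<in> P" for u
      using k[OF that] F(2) that by (auto simp: F0_def)
    have op: "open (- P)" using P by (simp add: finite_imp_closed open_Compl)
    have "boundary_integral F G = 2 * pi * \<i> * residue G z"
      using F z poles P by (intro boundary_integral_eq_residue[where P=P] holomorphic_on_subset[OF G]) auto
    also have "residue G z = 0" using residue_holo[OF op _ G] \<open>z \<notin> P\<close> by simp
    finally have "boundary_integral F G = 0" by simp
    moreover have "boundary_integral F (\<lambda>w. G w / (w - z)) = 2 * pi * \<i> * residue (\<lambda>w. G w / (w - z)) z"
      using F z poles P by (intro boundary_integral_eq_residue[where P=P] holomorphic_intros holomorphic_on_subset[OF G]) auto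
    moreover have "residue (\<lambda>w. G w / (w - z)) z = G z"
      using residue_simple[OF op _ G] \<open>z \<notin> P\<close> by simp
    moreover have "boundary_integral F g = boundary_integral F G"
      "boundary_integral F (\<lambda>w. g w / (w - z)) = boundary_integral F (\<lambda>w. G w / (w - z))" "g z = G z"
      using F pq z' by (auto intro!: boundary_integral_cong simp: G_def)
    ultimately show "boundary_integral F g = 0 \<and> boundary_integral F (\<lambda>w. g w / (w - z)) = 2 * pi * \<i> * g z"
      by simp
  qed (use P k in \<open>auto simp: F0_def\<close>)
qed

lemma contour_integrable_on_circles:
  assumes "continuous_on cheese f"
  shows "f contour_integrable_on (circlepath 0 2)"
    and "k \<in> A \<Longrightarrow> f contour_integrable_on (circlepath (c k) (r k))"
  using assms path_image_subset_cheese[of k] path_image_outer_subset_cheese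
  by (meson contour_integrable_continuous_circlepath continuous_on_subset)+

lemma circle_integral_bound:
  assumes "continuous_on cheese f" "\<And>w. w \<in> cheese \<Longrightarrow> norm (f w) \<le> M" "k \<in> A"
  shows "norm (contour_integral (circlepath (c k) (r k)) f) \<le> M * (2 * pi * r k)"
proof -
  have M: "0 \<le> M" using assms(2)[of 2] outer_sphere_subset_cheese norm_ge_zero[of "f 2"] by (force intro: order_trans[OF norm_ge_zero])
  show ?thesis
    using has_contour_integral_integral[OF contour_integrable_on_circles(2)[OF assms(1,3)]] M r_pos[OF assms(3)]
    by (rule has_contour_integral_bound_circlepath)
       (use assms sphere_subset_cheese[OF assms(3)] in \<open>auto simp: dist_norm norm_minus_commute subset_iff\<close>)
qed

text \<open>The outer circle has length 4 pi, and the removed ones together at most 2 pi since their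
  radii sum to at most 1.\<close>

lemma boundary_integral_bound:
  assumes f: "continuous_on cheese f" "\<And>w. w \<in> cheese \<Longrightarrow> norm (f w) \<le> M" and F: "finite F" "F \<subseteq> A"
  shows "norm (boundary_integral F f) \<le> 6 * pi * M"
proof -
  have M: "0 \<le> M" using f(2)[of 2] outer_sphere_subset_cheese norm_ge_zero[of "f 2"] by (force intro: order_trans[OF norm_ge_zero])
  have "norm (contour_integral (circlepath 0 2) f) \<le> M * (2 * pi * 2)"
    using has_contour_integral_integral[OF contour_integrable_on_circles(1)[OF f(1)]] M
    by (rule has_contour_integral_bound_circlepath)
       (use f outer_sphere_subset_cheese in \<open>auto simp: dist_norm subset_iff\<close>)
  moreover have "norm (\<Sum>k\<in>F. contour_integral (circlepath (c k) (r k)) f) \<le> (\<Sum>k\<in>F. M * (2 * pi * r k))"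
    using F circle_integral_bound[OF f] by (intro sum_norm_le) auto
  moreover have "(\<Sum>k\<in>F. M * (2 * pi * r k)) = M * (2 * pi) * sum r F"
    by (simp add: sum_distrib_left mult.assoc)
  moreover have "M * (2 * pi) * sum r F \<le> M * (2 * pi) * 1"
    using sum_r_le_1[OF F] M by (intro mult_left_mono) auto
  moreover have "M * (2 * pi * 2) + M * (2 * pi) * 1 = 6 * pi * M" by simp
  ultimately show ?thesis
    unfolding boundary_integral_def
    using norm_triangle_ineq4[of "contour_integral (circlepath 0 2) f" "\<Sum>k\<in>F. contour_integral (circlepath (c k) (r k)) f"]
    by linarith
qed

lemma boundary_integral_diff:
  assumes "continuous_on cheese f" "continuous_on cheese g" "F \<subseteq> A"
  shows "boundary_integral F (\<lambda>w. f w - g w) = boundary_integral F f - boundary_integral F g"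
proof -
  have "(\<Sum>k\<in>F. contour_integral (circlepath (c k) (r k)) (\<lambda>w. f w - g w)) =
    (\<Sum>k\<in>F. contour_integral (circlepath (c k) (r k)) f - contour_integral (circlepath (c k) (r k)) g)"
    using contour_integrable_on_circles assms by (intro sum.cong contour_integral_diff) blast+
  then show ?thesis
    using contour_integral_diff[OF contour_integrable_on_circles(1)[OF assms(1)] contour_integrable_on_circles(1)[OF assms(2)]]
    by (simp add: boundary_integral_def sum_subtractf)
qed

end

text \<open>On the circle dw is 2 pi i (w - c) dt, and the factor \<open>cnj (w - c)\<close> turns
  this into a constant times dt. The integral is then a non-zero constant times that of a
  non-negative bump, and nothing can cancel.\<close>

lemma circle_integral_bump:
  assumes "b \<in> sphere c r" "0 < r" "0 < d"
  shows "contour_integral (circlepath c r) (\<lambda>w. of_real (max 0 (d - norm (w - b))) * cnj (w - c)) \<noteq> 0"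
proof -
  define \<psi> where "\<psi> t = max 0 (d - norm (circlepath c r t - b))" for t
  have cont: "continuous_on {0..1} \<psi>"
    unfolding \<psi>_def circlepath by (intro continuous_intros)
  have "contour_integral (circlepath c r) (\<lambda>w. of_real (max 0 (d - norm (w - b))) * cnj (w - c))
     = integral {0..1} (\<lambda>t. (2 * pi * \<i> * r^2) * of_real (\<psi> t))"
    unfolding contour_integral_integral
  proof (rule integral_cong)
    fix t :: real assume "t \<in> {0..1}"
    have "(circlepath c r t - c) * cnj (circlepath c r t - c) = of_real ((norm (circlepath c r t - c))\<^sup>2)"
      by (metis complex_norm_square of_real_power)
    also have "norm (circlepath c r t - c) = r"
      using assms(2) by (simp add: circlepath norm_mult)
    finally have *: "(circlepath c r t - c) * cnj (circlepath c r t - c) = of_real r ^ 2" by simp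
    have vd: "vector_derivative (circlepath c r) (at t) = 2 * pi * \<i> * (circlepath c r t - c)"
      by (simp add: vector_derivative_circlepath) (simp add: circlepath)
    show "of_real (max 0 (d - norm (circlepath c r t - b))) * cnj (circlepath c r t - c) *
         vector_derivative (circlepath c r) (at t) = (2 * pi * \<i> * r^2) * of_real (\<psi> t)"
    proof -
      have "x * cnj w * (K * w) = K * (w * cnj w) * x" for x w K :: complex by (simp only: mult_ac)
      then show ?thesis using * vd by (simp add: \<psi>_def mult.commute)
    qed
  qed
  also have "\<dots> = (2 * pi * \<i> * r^2) * of_real (integral {0..1} \<psi>)"
    using has_integral_of_real[OF integrable_integral[OF integrable_continuous_interval[OF cont]], where 'b=complex]
    by (simp add: integral_mult_right integral_unique)
  finally have eq: "contour_integral (circlepath c r) (\<lambda>w. of_real (max 0 (d - norm (w - b))) * cnj (w - c)) = \<dots>" .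
  have "b \<in> path_image (circlepath c r)" using assms by simp
  then obtain t where "t \<in> {0..1}" "circlepath c r t = b" by (auto simp: path_image_def)
  then have "\<psi> t \<noteq> 0" using assms by (simp add: \<psi>_def)
  then have "integral {0..1} \<psi> \<noteq> 0"
    using integral_eq_0_iff[OF cont] \<open>t \<in> {0..1}\<close> by (auto simp: \<psi>_def)
  then show ?thesis using assms eq by simp
qed

context disc_family
begin

text \<open>A proper closed E of the forbidden kind would put into R(X) a bump at a point b of some
  removed circle near a point off E. The integral of the bump over that circle is a fixed \<kappa>
  different from 0; the work lies in keeping all other circles from compensating it.\<close>

lemma R_essential_cheese:
  assumes dense: "\<And>p d. p \<in> cheese \<Longrightarrow> 0 < d \<Longrightarrow> \<exists>k\<in>A. ball p d \<inter> ball (c k) (r k) \<noteq> {}"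
    and z0: "norm z0 < 2" "\<And>k. k \<in> A \<Longrightarrow> z0 \<notin> cball (c k) (r k)"
  shows "R_essential cheese"
  unfolding R_essential_def
proof (rule notI, elim exE conjE)
  fix E assume E: "closedin (top_of_set cheese) E" "E \<noteq> cheese"
    and sub: "{f \<in> C_alg cheese. \<forall>y\<in>E. f y = 0} \<subseteq> R_alg cheese"
  have "closed E" using E(1) compact_cheese closedin_closed_trans compact_imp_closed by blast
  obtain p where p: "p \<in> cheese" "p \<notin> E" using E closedin_imp_subset by blast
  obtain d where d: "d > 0" "ball p d \<subseteq> - E"
    using \<open>closed E\<close> p(2) by (metis ComplI open_Compl openE)
  obtain k where k: "k \<in> A" "ball p d \<inter> ball (c k) (r k) \<noteq> {}" using dense[OF p(1) d(1)] by blast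
  have "p \<notin> ball (c k) (r k)" using p k by (auto simp: cheese_def)
  then have "ball p d \<inter> frontier (ball (c k) (r k)) \<noteq> {}"
    using d k by (intro connected_Int_frontier) (auto simp: set_eq_iff intro!: exI[of _ p])
  then obtain b where b: "b \<in> sphere (c k) (r k)" "b \<in> ball p d" using r_pos[OF k(1)] by (auto simp: frontier_ball)
  obtain \<delta> where \<delta>: "\<delta> > 0" "ball b \<delta> \<subseteq> ball p d" using b(2) by (meson open_ball openE)
  \<comment> \<open>The last factor equals 1 on circle k and, for large n, vanishes on any given
    compact set that misses this circle. Bound and integral do not depend on n, so the finite set F1
    below can be fixed before n.\<close>
  define f where "f n w = of_real (max 0 (\<delta> - norm (w - b))) * cnj (w - c k) * of_real (max 0 (1 - real n * \<bar>norm (w - c k) - r k\<bar>))" for n w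
  have f_cont: "continuous_on S (f n)" for n S unfolding f_def by (intro continuous_intros)
  have "f n \<in> C_alg cheese" "\<forall>y\<in>E. f n y = 0" for n
  proof -
    show "f n \<in> C_alg cheese" using f_cont by (simp add: C_alg_def)
    have "y \<notin> ball b \<delta>" if "y \<in> E" for y using that \<delta> d by blast
    then have "max 0 (\<delta> - norm (y - b)) = 0" if "y \<in> E" for y
      using that by (force simp: dist_norm norm_minus_commute)
    then show "\<forall>y\<in>E. f n y = 0" by (simp add: f_def)
  qed
  then have fR: "f n \<in> R_alg cheese" for n using sub by blast
  define M where "M = \<delta> * 4"
  have "0 < M" using \<delta> by (simp add: M_def)
  have f_bound: "norm (f n w) \<le> M" if "w \<in> cheese" for n w
  proof -
    have "norm (c k) < 2" using inside[OF k(1)] r_pos[OF k(1)] by (auto simp: subset_iff dest!: spec[of _ "c k"])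
    then have "norm (w - c k) \<le> 4" using norm_triangle_ineq4[of w "c k"] that by (simp add: cheese_def)
    then have "max 0 (\<delta> - norm (w - b)) * norm (w - c k) * max 0 (1 - real n * \<bar>norm (w - c k) - r k\<bar>) \<le> \<delta> * 4 * 1"
      using \<delta> by (intro mult_mono) auto
    then show ?thesis by (simp add: f_def norm_mult M_def del: complex_cnj_diff)
  qed
  define \<kappa> where "\<kappa> = contour_integral (circlepath (c k) (r k)) (\<lambda>w. of_real (max 0 (\<delta> - norm (w - b))) * cnj (w - c k))"
  have "\<kappa> \<noteq> 0" unfolding \<kappa>_def using b r_pos[OF k(1)] \<delta> by (intro circle_integral_bump)
  have \<kappa>_eq: "contour_integral (circlepath (c k) (r k)) (f n) = \<kappa>" for n
    unfolding \<kappa>_def using r_pos[OF k(1)] by (intro contour_integral_eq) (auto simp: f_def dist_norm norm_minus_commute)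
  obtain F1 where F1: "finite F1" "F1 \<subseteq> A" "\<And>G. finite G \<Longrightarrow> G \<subseteq> A - F1 \<Longrightarrow> sum r G < norm \<kappa> / 4 / (2 * pi * M)"
    using finite_tail[of "norm \<kappa> / 4 / (2 * pi * M)"] \<open>\<kappa> \<noteq> 0\<close> \<open>0 < M\<close> by auto
  define W where "W = sphere 0 2 \<union> (\<Union>j\<in>F1-{k}. sphere (c j) (r j))"
  have "compact W" unfolding W_def using F1 by (intro compact_Un compact_UN) auto
  have pos: "\<bar>norm (w - c k) - r k\<bar> > 0" if "w \<in> W" for w
  proof -
    have "w \<notin> sphere (c k) (r k)"
      using that unfolding W_def
    proof
      assume "w \<in> sphere 0 2"
      then have "w \<notin> cball (c k) (r k)" using inside[OF k(1)] by auto
      then show ?thesis by auto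
    next
      assume "w \<in> (\<Union>j\<in>F1-{k}. sphere (c j) (r j))"
      then obtain j where "j \<in> F1" "j \<noteq> k" "w \<in> sphere (c j) (r j)" by blast
      moreover from this have "w \<in> cball (c j) (r j)" by auto
      ultimately have "w \<notin> cball (c k) (r k)" using disj[OF k(1), of j] F1(2) by blast
      then show ?thesis by auto
    qed
    then show ?thesis by (auto simp: dist_norm norm_minus_commute)
  qed
  have "continuous_on W (\<lambda>w. \<bar>norm (w - c k) - r k\<bar>)" by (intro continuous_intros)
  moreover have "W \<noteq> {}" by (auto simp: W_def)
  ultimately obtain w0 where w0: "w0 \<in> W" "\<forall>w\<in>W. \<bar>norm (w0 - c k) - r k\<bar> \<le> \<bar>norm (w - c k) - r k\<bar>"
    using continuous_attains_inf[OF \<open>compact W\<close>] by blast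
  define m where "m = \<bar>norm (w0 - c k) - r k\<bar>"
  have m: "m > 0" "\<And>w. w \<in> W \<Longrightarrow> m \<le> \<bar>norm (w - c k) - r k\<bar>"
    using pos[OF w0(1)] w0(2) by (auto simp: m_def)
  obtain n where n: "1 / m \<le> real n" using real_arch_simple by blast
  have fW: "f n w = 0" if "w \<in> W" for w
  proof -
    have "1 = 1 / m * m" using m(1) by simp
    also have "\<dots> \<le> real n * \<bar>norm (w - c k) - r k\<bar>" using m n that by (intro mult_mono) auto
    finally show ?thesis by (simp add: f_def)
  qed
  \<comment> \<open>Approximating \<open>f n\<close> up to e by a rational g, whose boundary
    integral is 0, leaves at most norm \<kappa> / 2. The circles outside F1 add less than norm
    \<kappa> / 4, so \<kappa> would be smaller than three quarters of itself.\<close>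
  define e where "e = norm \<kappa> / 2 / (6 * pi)"
  have "e > 0" using \<open>\<kappa> \<noteq> 0\<close> by (simp add: e_def)
  then obtain g where g: "g \<in> rational_on cheese" "\<And>w. w \<in> cheese \<Longrightarrow> norm (f n w - g w) < e"
    using fR[of n] by (auto simp: R_alg_def)
  obtain F0 where F0: "finite F0" "F0 \<subseteq> A" "\<And>F. finite F \<Longrightarrow> F0 \<subseteq> F \<Longrightarrow> F \<subseteq> A \<Longrightarrow> boundary_integral F g = 0"
    using rational_cauchy[OF g(1)] z0 by metis
  define F where "F = insert k (F0 \<union> F1)"
  have F: "finite F" "F0 \<subseteq> F" "F \<subseteq> A" using F0 F1 k by (auto simp: F_def)
  have "norm (boundary_integral F (\<lambda>w. f n w - g w)) \<le> 6 * pi * e"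
    using F g f_cont rational_on_continuous
    by (intro boundary_integral_bound continuous_intros) (auto intro: less_imp_le)
  also have "boundary_integral F (\<lambda>w. f n w - g w) = boundary_integral F (f n)"
    using boundary_integral_diff[OF f_cont rational_on_continuous[OF g(1)] F(3)] F0(3)[OF F] by simp
  finally have small: "norm (boundary_integral F (f n)) \<le> norm \<kappa> / 2" by (simp add: e_def)
  define T where "T = F - insert k F1"
  have T: "finite T" "T \<subseteq> A - F1" using F by (auto simp: T_def)
  have "contour_integral (circlepath (c j) (r j)) (f n) = 0" if "j \<in> F1 - {k}" for j
  proof -
    have "j \<in> A" using that F1 by blast
    then have "path_image (circlepath (c j) (r j)) \<subseteq> W" using r_pos[of j] that unfolding W_def by auto
    then have "contour_integral (circlepath (c j) (r j)) (f n) = contour_integral (circlepath (c j) (r j)) (\<lambda>w. 0)"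
      using fW by (intro contour_integral_eq) blast
    then show ?thesis by simp
  qed
  moreover have "contour_integral (circlepath 0 2) (f n) = 0"
  proof -
    have "path_image (circlepath 0 2) \<subseteq> W" by (simp add: W_def)
    then have "contour_integral (circlepath 0 2) (f n) = contour_integral (circlepath 0 2) (\<lambda>w. 0)"
      using fW by (intro contour_integral_eq) blast
    then show ?thesis by simp
  qed
  moreover have "sum J F = J k + (sum J (F1 - {k}) + sum J T)" for J :: "'i \<Rightarrow> complex"
  proof -
    have "F = insert k ((F1 - {k}) \<union> T)" by (auto simp: T_def F_def)
    moreover have "k \<notin> (F1 - {k}) \<union> T" "(F1 - {k}) \<inter> T = {}" by (auto simp: T_def)
    ultimately show ?thesis using F1(1) T(1) by (metis finite_Diff finite_UnI sum.insert sum.union_disjoint)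
  qed
  ultimately have "\<kappa> = - boundary_integral F (f n) - (\<Sum>j\<in>T. contour_integral (circlepath (c j) (r j)) (f n))"
    by (simp add: boundary_integral_def \<kappa>_eq)
  then have "norm \<kappa> \<le> norm (boundary_integral F (f n)) + norm (\<Sum>j\<in>T. contour_integral (circlepath (c j) (r j)) (f n))"
    by (metis norm_minus_cancel norm_triangle_ineq4)
  moreover have "norm (\<Sum>j\<in>T. contour_integral (circlepath (c j) (r j)) (f n)) \<le> (\<Sum>j\<in>T. M * (2 * pi * r j))"
    using T circle_integral_bound[OF f_cont f_bound] by (intro sum_norm_le) auto
  moreover have "(\<Sum>j\<in>T. M * (2 * pi * r j)) = (2 * pi * M) * sum r T"
    by (subst sum_distrib_left, intro sum.cong) auto
  moreover have "(2 * pi * M) * sum r T < norm \<kappa> / 4"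
    using F1(3)[OF T] \<open>0 < M\<close> by (simp add: field_simps)
  ultimately have "norm \<kappa> < norm (boundary_integral F (f n)) + norm \<kappa> / 4"
    by linarith
  moreover have "0 < norm \<kappa>" using \<open>\<kappa> \<noteq> 0\<close> by simp
  ultimately show False using small by linarith
qed

end

text \<open>The empty set is a proper closed subset, and the functions vanishing on it are all of
  C(X).\<close>

lemma R_essential_imp_nontrivial: "X \<noteq> {} \<Longrightarrow> R_essential X \<Longrightarrow> R_nontrivial X"
  unfolding R_essential_def R_nontrivial_def by (metis (no_types, lifting) closedin_empty mem_Collect_eq subsetI)

section \<open>Unique continuation along the segment\<close>

definition tube :: "real \<Rightarrow> complex set" where
  "tube d = (\<Union>t\<in>{0..1}. ball (complex_of_real t) d)"

lemma open_tube: "open (tube d)"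
  unfolding tube_def by auto

lemma segment_subset_tube: "0 < d \<Longrightarrow> t \<in> {0..1} \<Longrightarrow> complex_of_real t \<in> tube d"
  unfolding tube_def by force

lemma connected_tube:
  assumes "0 < d"
  shows "connected (tube d)"
proof -
  have "connected (complex_of_real ` {0..1})"
    by (intro connected_continuous_image continuous_intros) auto
  then have "connected (complex_of_real ` {0..1} \<union> \<Union>((\<lambda>t. ball (complex_of_real t) d) ` {0..1}))"
    using assms by (intro connected_Un_UN) auto
  moreover have "complex_of_real ` {0..1} \<union> \<Union>((\<lambda>t. ball (complex_of_real t) d) ` {0..1}) = tube d"
    using assms by (auto simp: tube_def)
  ultimately show ?thesis by simp
qed

text \<open>\<open>\<eta>\<close> depends only on \<open>d\<close> and \<open>e\<close>; the discs removed at later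
  stages are chosen small relative to it.\<close>

definition propagates :: "real \<Rightarrow> real \<Rightarrow> real \<Rightarrow> bool" where
  "propagates d e \<eta> \<longleftrightarrow> 0 < \<eta> \<and> (\<forall>G. G holomorphic_on tube d \<longrightarrow> (\<forall>z\<in>tube d. norm (G z) \<le> 3 + 1 / d) \<longrightarrow>
     (\<forall>t\<in>{0..1/2}. norm (G (complex_of_real t)) \<le> \<eta>) \<longrightarrow> norm (G 1) \<le> e)"

text \<open>If every bound 1/(n+1) on the left half failed, a subsequence of counterexamples would
  converge by Montel's theorem to a holomorphic function that vanishes on the left half, hence at 1,
  against the values above e there. No formula for \<eta> results.\<close>

lemma propagates_ex:
  assumes "0 < d" "0 < e"
  shows "\<exists>\<eta>. propagates d e \<eta>"
proof (rule ccontr)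
  assume "\<not> ?thesis"
  then have neg: "\<not> propagates d e (1 / (real n + 1))" for n by blast
  have "\<exists>G. G holomorphic_on tube d \<and> (\<forall>z\<in>tube d. norm (G z) \<le> 3 + 1 / d) \<and>
     (\<forall>t\<in>{0..1/2}. norm (G (complex_of_real t)) \<le> 1 / (real n + 1)) \<and> e < norm (G 1)" for n
    using neg[of n] unfolding propagates_def by (auto simp: not_le)
  then obtain G where G: "\<And>n. G n holomorphic_on tube d" "\<And>n z. z \<in> tube d \<Longrightarrow> norm (G n z) \<le> 3 + 1 / d"
    "\<And>n t. t \<in> {0..1/2} \<Longrightarrow> norm (G n (complex_of_real t)) \<le> 1 / (real n + 1)" "\<And>n. e < norm (G n 1)"
    by metis
  define H where "H = {h. h holomorphic_on tube d \<and> (\<forall>z\<in>tube d. norm (h z) \<le> 3 + 1 / d)}"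
  obtain g \<sigma> where g: "g holomorphic_on tube d" "strict_mono (\<sigma> :: nat \<Rightarrow> nat)"
    "\<And>x. x \<in> tube d \<Longrightarrow> (\<lambda>n. G (\<sigma> n) x) \<longlonglongrightarrow> g x"
  proof (rule Montel[of "tube d" H G])
    show "\<exists>B. \<forall>h\<in>H. \<forall>z\<in>K. norm (h z) \<le> B" if "K \<subseteq> tube d" for K
      using that by (intro exI[of _ "3 + 1 / d"]) (auto simp: H_def)
  qed (use G open_tube in \<open>auto simp: H_def\<close>)
  have zero: "g z = 0" if z: "z \<in> complex_of_real ` {0..1/2}" for z
  proof -
    obtain t where t: "t \<in> {0..1/2}" "z = complex_of_real t" using z by blast
    have lim: "(\<lambda>n. G (\<sigma> n) z) \<longlonglongrightarrow> g z" using g(3) segment_subset_tube[OF assms(1), of t] t by auto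
    have "(\<lambda>n. 1 / (real n + 1)) \<longlonglongrightarrow> 0" by real_asymp
    then have "(\<lambda>n. 1 / (real (\<sigma> n) + 1)) \<longlonglongrightarrow> 0"
      using LIMSEQ_subseq_LIMSEQ[OF _ g(2), of "\<lambda>n. 1 / (real n + 1)" 0] by (simp add: o_def)
    moreover have "\<forall>n. norm (G (\<sigma> n) z) \<le> 1 / (real (\<sigma> n) + 1)" using G(3)[OF t(1)] t(2) by simp
    ultimately have "(\<lambda>n. G (\<sigma> n) z) \<longlonglongrightarrow> 0"
      by (intro Lim_null_comparison[OF always_eventually, of "\<lambda>n. G (\<sigma> n) z"])
    then show "g z = 0" using lim LIMSEQ_unique by blast
  qed
  have "complex_of_real 0 islimpt complex_of_real ` {0..1/2}"
    unfolding islimpt_sequential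
  proof (intro exI[of _ "\<lambda>n. complex_of_real (1 / (real n + 2))"] conjI allI)
    show "(\<lambda>n. complex_of_real (1 / (real n + 2))) \<longlonglongrightarrow> complex_of_real 0"
      by (intro tendsto_of_real) real_asymp
    fix n :: nat
    have "1 / (real n + 2) \<in> {0..1/2}" by (auto simp: field_simps)
    moreover have "complex_of_real (1 / (real n + 2)) \<noteq> complex_of_real 0"
      by (subst of_real_eq_iff) (auto simp: field_simps)
    ultimately show "complex_of_real (1 / (real n + 2)) \<in> complex_of_real ` {0..1/2} - {complex_of_real 0}"
      by (intro DiffI imageI) auto
  qed
  then have "g 1 = 0"
    using analytic_continuation[OF g(1) open_tube connected_tube[OF assms(1)], of "complex_of_real ` {0..1/2}" 0 1]
      zero segment_subset_tube[OF assms(1)] segment_subset_tube[OF assms(1), of 0] segment_subset_tube[OF assms(1), of 1]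
    by (auto simp: image_subset_iff)
  moreover have "(\<lambda>n. norm (G (\<sigma> n) 1)) \<longlonglongrightarrow> norm (g 1)"
    using g(3)[of 1] segment_subset_tube[OF assms(1), of 1] by (intro tendsto_norm) auto
  ultimately have "e \<le> 0"
    using G(4) by (intro tendsto_lowerbound[where f="\<lambda>n. norm (G (\<sigma> n) 1)" and F=sequentially]) (auto intro: always_eventually less_imp_le)
  then show False using assms by simp
qed

lemma norm_circle_integral_le:
  assumes "continuous_on (sphere a s) h" "\<And>w. w \<in> sphere a s \<Longrightarrow> norm (h w) \<le> B" "0 < s" "0 \<le> B"
  shows "norm (contour_integral (circlepath a s) h) \<le> B * (2 * pi * s)"
proof -
  have "h contour_integrable_on circlepath a s"
    using assms by (intro contour_integrable_continuous_circlepath) auto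
  then show ?thesis
    using has_contour_integral_bound_circlepath[OF has_contour_integral_integral, of h a s B] assms
    by (auto simp: dist_norm norm_minus_commute)
qed

lemma holomorphic_circle_cauchy_integral:
  assumes g: "continuous_on (sphere a s) g" "0 < s" and U: "open U" "U \<inter> sphere a s = {}"
  shows "(\<lambda>z. contour_integral (circlepath a s) (\<lambda>w. g w / (w - z))) holomorphic_on U"
proof -
  have pi: "path_image (circlepath a s) = sphere a s" using g(2) by simp
  have int: "((\<lambda>w. g w / (w - z) ^ 1) has_contour_integral contour_integral (circlepath a s) (\<lambda>w. g w / (w - z))) (circlepath a s)"
    if "z \<in> U - path_image (circlepath a s)" for z
  proof -
    have "(\<lambda>w. g w / (w - z)) contour_integrable_on circlepath a s"
      using that g pi by (intro contour_integrable_continuous_circlepath continuous_intros) auto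
    then show ?thesis by (simp add: has_contour_integral_integral)
  qed
  have "\<exists>D. ((\<lambda>z. contour_integral (circlepath a s) (\<lambda>w. g w / (w - z))) has_field_derivative D) (at z)" if "z \<in> U" for z
  proof -
    have "z \<in> U - path_image (circlepath a s)" using that U pi by auto
    then show ?thesis
      using Cauchy_next_derivative(2)[where f'=g and \<gamma>="circlepath a s" and B="2 * pi * s" and S=U and k=1
        and f="\<lambda>z. contour_integral (circlepath a s) (\<lambda>w. g w / (w - z))" and w=z] int U(1) g pi
      by (auto simp: vector_derivative_circlepath norm_mult)
  qed
  then show ?thesis using holomorphic_on_open[OF U(1)] by blast
qed

context disc_family
begin

text \<open>The discs in B keep distance 2d from the segment, so their share of the Cauchy integral
  is holomorphic on the tube with a bound in terms of d alone. The others may come arbitrarily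
  close, but at a point of the segment they contribute at most a multiple of the sum of
  \<open>r k / s k\<close>. It is essential that \<eta> may depend on d.\<close>

lemma not_R_regular_cheese:
  assumes I: "\<And>t k. t \<in> {0..1} \<Longrightarrow> k \<in> A \<Longrightarrow> complex_of_real t \<notin> cball (c k) (r k)"
    and key: "\<And>e. 0 < e \<Longrightarrow> \<exists>d \<eta> B s. 0 < d \<and> d \<le> 1/2 \<and> propagates d e \<eta> \<and> \<eta> \<le> e \<and> B \<subseteq> A \<and>
      (\<forall>k\<in>B. \<forall>w\<in>cball (c k) (r k). \<forall>t\<in>{0..1}. 2 * d \<le> norm (w - complex_of_real t)) \<and>
      (\<forall>k\<in>A-B. 0 < s k \<and> (\<forall>w\<in>cball (c k) (r k). \<forall>t\<in>{0..1}. s k \<le> norm (w - complex_of_real t))) \<and>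
      (\<forall>F. finite F \<longrightarrow> F \<subseteq> A - B \<longrightarrow> (\<Sum>k\<in>F. r k / s k) \<le> \<eta>)"
  shows "\<not> R_regular cheese"
proof
  assume reg: "R_regular cheese"
  have seg: "complex_of_real t \<in> cheese" if "t \<in> {0..1}" for t
    using I[OF that] that ball_subset_cball unfolding cheese_def by fastforce
  define E where "E = complex_of_real ` {0..1/2}"
  have "compact E" unfolding E_def by (intro compact_continuous_image continuous_intros) auto
  then have "closedin (top_of_set cheese) E"
    using seg unfolding E_def by (intro closed_subset compact_imp_closed image_subsetI) auto
  moreover have "1 \<in> cheese - E"
  proof -
    have "Re z \<le> 1/2" if "z \<in> E" for z using that by (auto simp: E_def)
    from this[of 1] show ?thesis using seg[of 1] by auto
  qed
  ultimately obtain f where f: "f \<in> R_alg cheese" "f 1 = 1" "f ` E \<subseteq> {0}"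
    using reg unfolding R_regular_def by blast
  have f_cont: "continuous_on cheese f" using f by (auto simp: R_alg_def C_alg_def)
  obtain M' where M': "\<And>w. w \<in> cheese \<Longrightarrow> norm (f w) \<le> M'"
    using compact_continuous_image[OF f_cont compact_cheese, THEN compact_imp_bounded] unfolding bounded_iff by blast
  define M where "M = max 1 M'"
  have M: "1 \<le> M" "\<And>w. w \<in> cheese \<Longrightarrow> norm (f w) \<le> M" using M' by (auto simp: M_def intro: max.coboundedI2)
  \<comment> \<open>The final estimate splits 1 into 1 - g(1), G(1) and H(1), which are at most
    \<open>M * e\<close>, \<open>3 * M * e\<close> and \<open>2 * M * e\<close> in norm; the total
    stays below \<open>7 * M * e\<close>, hence below 1. The cap 1/2 keeps g below
    \<open>2 * M\<close>.\<close>
  define e where "e = min (1/2) (1 / (7 * M))"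
  have e: "0 < e" "e \<le> 1/2" "e \<le> 1 / (7 * M)" using M(1) by (auto simp: e_def)
  obtain d \<eta> B s where K: "0 < d \<and> d \<le> 1/2 \<and> propagates d e \<eta> \<and> \<eta> \<le> e \<and> B \<subseteq> A \<and>
      (\<forall>k\<in>B. \<forall>w\<in>cball (c k) (r k). \<forall>t\<in>{0..1}. 2 * d \<le> norm (w - complex_of_real t)) \<and>
      (\<forall>k\<in>A-B. 0 < s k \<and> (\<forall>w\<in>cball (c k) (r k). \<forall>t\<in>{0..1}. s k \<le> norm (w - complex_of_real t))) \<and>
      (\<forall>F. finite F \<longrightarrow> F \<subseteq> A - B \<longrightarrow> (\<Sum>k\<in>F. r k / s k) \<le> \<eta>)"
    using key[OF e(1)] by (elim exE) (rule that)
  have d: "0 < d" "d \<le> 1/2" and \<eta>: "propagates d e \<eta>" "\<eta> \<le> e" using K by auto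
  have B: "2 * d \<le> norm (w - complex_of_real t)" if "k \<in> B" "w \<in> cball (c k) (r k)" "t \<in> {0..1}" for k w t
    using K that by blast
  have s: "0 < s k" "\<And>w t. w \<in> cball (c k) (r k) \<Longrightarrow> t \<in> {0..1} \<Longrightarrow> s k \<le> norm (w - complex_of_real t)"
    if "k \<in> A - B" for k
    using K that by blast+
  have s_sum: "(\<Sum>k\<in>F. r k / s k) \<le> \<eta>" if "finite F" "F \<subseteq> A - B" for F
    using K that by blast
  have \<eta>_pos: "0 < \<eta>" using \<eta> by (simp add: propagates_def)
  \<comment> \<open>The approximation error is measured in \<eta> so that g is as small on the left
    half of the segment as the contribution of the discs outside B.\<close>
  have "0 < M * \<eta>" using \<eta>_pos M(1) by simp
  then obtain g where g: "g \<in> rational_on cheese" "\<And>w. w \<in> cheese \<Longrightarrow> norm (f w - g w) < M * \<eta>"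
    using f(1) unfolding R_alg_def by blast
  have g_cont: "continuous_on cheese g" using g rational_on_continuous by blast
  have g2M: "norm (g w) \<le> 2 * M" if "w \<in> cheese" for w
  proof -
    have "norm (g w) \<le> norm (f w) + norm (f w - g w)" by (metis norm_minus_commute norm_triangle_sub)
    moreover have "M * \<eta> \<le> M * 1" using M(1) \<eta>(2) e by (intro mult_left_mono) auto
    ultimately show ?thesis using M(2)[OF that] g(2)[OF that] by linarith
  qed
  obtain F where F: "finite F" "F \<subseteq> A" "\<And>F' z. finite F' \<Longrightarrow> F \<subseteq> F' \<Longrightarrow> F' \<subseteq> A \<Longrightarrow> norm z < 2 \<Longrightarrow>
      (\<And>k. k \<in> A \<Longrightarrow> z \<notin> cball (c k) (r k)) \<Longrightarrow>
      boundary_integral F' g = 0 \<and> boundary_integral F' (\<lambda>w. g w / (w - z)) = 2 * pi * \<i> * g z"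
    by (rule rational_cauchy[OF g(1)], rule that, assumption, assumption, blast)
  \<comment> \<open>G collects the outer circle and the circles far from the segment, H the near
    ones. By Cauchy's formula g = G + H on the segment; only G is continued into the tube.\<close>
  define G where "G z = boundary_integral (F \<inter> B) (\<lambda>w. g w / (w - z)) / (2 * pi * \<i>)" for z
  define H where "H z = - (\<Sum>k\<in>F-B. contour_integral (circlepath (c k) (r k)) (\<lambda>w. g w / (w - z))) / (2 * pi * \<i>)" for z
  have split: "g (of_real t) = G (of_real t) + H (of_real t)" if "t \<in> {0..1}" for t
  proof -
    have "boundary_integral F (\<lambda>w. g w / (w - of_real t)) = 2 * pi * \<i> * g (of_real t)"
      using F(3)[OF F(1) order_refl F(2), of "of_real t"] I[OF that] that by auto
    moreover have "boundary_integral F h = boundary_integral (F \<inter> B) h - (\<Sum>k\<in>F-B. contour_integral (circlepath (c k) (r k)) h)" for h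
      using sum.Int_Diff[OF F(1), of "\<lambda>k. contour_integral (circlepath (c k) (r k)) h" B]
      by (simp add: boundary_integral_def)
    ultimately show ?thesis
      unfolding G_def H_def by (simp add: diff_divide_distrib flip: add_divide_distrib) (simp add: field_simps)
  qed
  have sph: "continuous_on (sphere (c k) (r k)) g" "\<And>w. w \<in> sphere (c k) (r k) \<Longrightarrow> norm (g w) \<le> 2 * M" if "k \<in> A" for k
    using sphere_subset_cheese[OF that] g_cont g2M by (auto intro: continuous_on_subset)
  have sph0: "continuous_on (sphere 0 2) g" "\<And>w. w \<in> sphere 0 2 \<Longrightarrow> norm (g w) \<le> 2 * M"
    using outer_sphere_subset_cheese g_cont g2M by (auto intro: continuous_on_subset)
  have circ: "norm (contour_integral (circlepath a \<rho>) (\<lambda>w. g w / (w - z))) \<le> (2 * M / \<mu>) * (2 * pi * \<rho>)"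
    if "continuous_on (sphere a \<rho>) g" "\<And>w. w \<in> sphere a \<rho> \<Longrightarrow> norm (g w) \<le> 2 * M" "0 < \<rho>" "0 < \<mu>"
      "\<And>w. w \<in> sphere a \<rho> \<Longrightarrow> \<mu> \<le> norm (w - z)" for a \<rho> \<mu> z
  proof (rule norm_circle_integral_le)
    have "w \<noteq> z" if "w \<in> sphere a \<rho>" for w using \<open>0 < \<mu>\<close> \<open>\<And>w. w \<in> sphere a \<rho> \<Longrightarrow> \<mu> \<le> norm (w - z)\<close>[OF that] by auto
    then show "continuous_on (sphere a \<rho>) (\<lambda>w. g w / (w - z))" using that(1) by (intro continuous_intros) auto
    show "norm (g w / (w - z)) \<le> 2 * M / \<mu>" if "w \<in> sphere a \<rho>" for w
      using that \<open>\<And>w. w \<in> sphere a \<rho> \<Longrightarrow> \<mu> \<le> norm (w - z)\<close> \<open>\<And>w. w \<in> sphere a \<rho> \<Longrightarrow> norm (g w) \<le> 2 * M\<close> \<open>0 < \<mu>\<close> M(1)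
      unfolding norm_divide by (intro frac_le) auto
  qed (use that M(1) in auto)
  have H_bound: "norm (H (of_real t)) \<le> 2 * M * \<eta>" if t: "t \<in> {0..1}" for t
  proof -
    have "norm (\<Sum>k\<in>F-B. contour_integral (circlepath (c k) (r k)) (\<lambda>w. g w / (w - of_real t))) \<le> (\<Sum>k\<in>F-B. (2 * M / s k) * (2 * pi * r k))"
    proof (intro sum_norm_le circ)
      fix k assume k: "k \<in> F - B"
      then have k': "k \<in> A - B" "k \<in> A" using F by auto
      show "s k \<le> norm (w - of_real t)" if "w \<in> sphere (c k) (r k)" for w
        using s(2)[OF k'(1), of w t] t that by auto
    qed (use F s(1) sph r_pos in auto)
    also have "\<dots> = (2 * M * (2 * pi)) * (\<Sum>k\<in>F-B. r k / s k)"
      by (subst sum_distrib_left, intro sum.cong) (auto simp: field_simps)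
    also have "\<dots> \<le> (2 * M * (2 * pi)) * \<eta>"
      using s_sum[of "F - B"] F M(1) by (intro mult_left_mono) auto
    finally show ?thesis by (simp add: H_def norm_divide norm_mult field_simps)
  qed
  have sum_F: "sum r (F \<inter> B) \<le> 1" using F by (intro sum_r_le_1) auto
  have far: "d \<le> norm (w - z)" if "z \<in> tube d" "k \<in> F \<inter> B" "w \<in> sphere (c k) (r k)" for z k w
  proof -
    obtain t where t: "t \<in> {0..1}" "dist (complex_of_real t) z < d" using \<open>z \<in> tube d\<close> by (auto simp: tube_def)
    have "2 * d \<le> norm (w - complex_of_real t)" using B[of k w t] that t by auto
    moreover have "norm (w - complex_of_real t) \<le> norm (w - z) + dist (complex_of_real t) z"
      by (metis dist_norm dist_triangle2)
    ultimately show ?thesis using t(2) by linarith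
  qed
  \<comment> \<open>A point of the tube has norm below 1 + d, which is at most 3/2.\<close>
  have far0: "1/2 \<le> norm (w - z)" if "z \<in> tube d" "w \<in> sphere 0 2" for z w
  proof -
    obtain t where t: "t \<in> {0..1}" "dist (complex_of_real t) z < d" using \<open>z \<in> tube d\<close> by (auto simp: tube_def)
    have "norm z \<le> norm (complex_of_real t) + dist (complex_of_real t) z"
      by (metis dist_norm norm_minus_commute norm_triangle_sub)
    moreover have "norm w \<le> norm (w - z) + norm z" by (metis norm_triangle_sub add.commute)
    ultimately show ?thesis using t d that by auto
  qed
  have G_bound: "norm (G z) \<le> 8 * M + 2 * M / d" if z: "z \<in> tube d" for z
  proof -
    have 1: "norm (contour_integral (circlepath 0 2) (\<lambda>w. g w / (w - z))) \<le> (2 * M / (1/2)) * (2 * pi * 2)"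
      using sph0 far0[OF z] by (intro circ) auto
    have "norm (\<Sum>k\<in>F\<inter>B. contour_integral (circlepath (c k) (r k)) (\<lambda>w. g w / (w - z))) \<le> (\<Sum>k\<in>F\<inter>B. (2 * M / d) * (2 * pi * r k))"
      using F sph r_pos far[OF z] d by (intro sum_norm_le circ) auto
    also have "\<dots> = (2 * M / d) * (2 * pi) * sum r (F \<inter> B)"
      by (subst sum_distrib_left, intro sum.cong) (auto simp: field_simps)
    also have "\<dots> \<le> (2 * M / d) * (2 * pi) * 1"
      using sum_F M(1) d by (intro mult_left_mono) auto
    finally have "norm (boundary_integral (F \<inter> B) (\<lambda>w. g w / (w - z))) \<le> (2 * M / (1/2)) * (2 * pi * 2) + (2 * M / d) * (2 * pi) * 1"
      using 1 norm_triangle_ineq4 unfolding boundary_integral_def by (meson add_mono order_trans)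
    also have "\<dots> = (8 * M + 2 * M / d) * (2 * pi)" by (simp add: algebra_simps)
    finally show ?thesis by (simp add: G_def norm_divide norm_mult field_simps)
  qed
  have G_hol: "G holomorphic_on tube d"
    unfolding G_def boundary_integral_def
  proof (intro holomorphic_intros holomorphic_circle_cauchy_integral open_tube sph0)
    show "tube d \<inter> sphere 0 2 = {}" using far0 by force
    fix k assume k: "k \<in> F \<inter> B"
    then show "continuous_on (sphere (c k) (r k)) g" "0 < r k" using F sph r_pos by auto
    show "tube d \<inter> sphere (c k) (r k) = {}" using far[OF _ k] d by force
  qed auto
  have G_small: "norm (G (of_real t)) \<le> 3 * M * \<eta>" if t: "t \<in> {0..1/2}" for t
  proof -
    have t': "t \<in> {0..1}" using t by auto
    have "of_real t \<in> E" unfolding E_def using t by (rule imageI)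
    then have "f (of_real t) = 0" using f(3) by blast
    then have "norm (g (of_real t)) \<le> M * \<eta>" using g(2)[OF seg[OF t']] by simp
    moreover have "G (of_real t) = g (of_real t) - H (of_real t)" using split[OF t'] by simp
    ultimately show ?thesis
      using H_bound[OF t'] norm_triangle_ineq4[of "g (of_real t)" "H (of_real t)"] by simp
  qed
  \<comment> \<open>On the left half G is at most \<open>3 * M * \<eta>\<close>:
    \<open>M * \<eta>\<close> from g and twice that from H. Division by \<open>3 * M\<close>
    normalises this to \<eta> and turns \<open>8 * M + 2 * M / d\<close> into at most 3 + 1/d, the
    bound built into \<open>propagates\<close>.\<close>
  have "norm (G 1 / of_real (3 * M)) \<le> e"
  proof -
    have "(\<lambda>z. G z / of_real (3 * M)) holomorphic_on tube d"
      using M(1) by (intro holomorphic_intros G_hol) auto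
    moreover have "norm (G z / of_real (3 * M)) \<le> 3 + 1 / d" if "z \<in> tube d" for z
    proof -
      have "8 * M + 2 * M / d \<le> (3 + 1 / d) * (3 * M)" using M(1) d by (simp add: field_simps)
      then have "norm (G z) \<le> (3 + 1 / d) * (3 * M)" using G_bound[OF that] by linarith
      then show ?thesis using M(1) by (simp add: norm_divide norm_mult pos_divide_le_eq)
    qed
    moreover have "norm (G (of_real t) / of_real (3 * M)) \<le> \<eta>" if "t \<in> {0..1/2}" for t
      using G_small[OF that] M(1) by (simp add: norm_divide norm_mult pos_divide_le_eq mult_ac)
    ultimately show ?thesis using \<eta>(1) unfolding propagates_def by blast
  qed
  then have "norm (G 1) \<le> 3 * M * e" using M(1) by (simp add: norm_divide norm_mult pos_divide_le_eq mult_ac)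
  moreover have "g 1 = G 1 + H 1" using split[of 1] by simp
  moreover have "norm (H 1) \<le> 2 * M * \<eta>" using H_bound[of 1] by simp
  moreover have "norm (1 - g 1) < M * \<eta>" using g(2)[of 1] seg[of 1] f(2) by simp
  moreover have "norm (1::complex) \<le> norm (1 - g 1) + (norm (G 1) + norm (H 1))"
  proof -
    have "norm (1::complex) \<le> norm (1 - g 1) + norm (g 1)" using norm_triangle_ineq[of "1 - g 1" "g 1"] by simp
    also have "norm (g 1) \<le> norm (G 1) + norm (H 1)" unfolding \<open>g 1 = G 1 + H 1\<close> by (rule norm_triangle_ineq)
    finally show ?thesis by simp
  qed
  moreover have "M * \<eta> \<le> M * e" using M(1) \<eta>(2) by (intro mult_left_mono) auto
  moreover have "3 * M * e = 3 * (M * e)" "2 * M * \<eta> = 2 * (M * \<eta>)" "norm (1::complex) = 1" by simp_all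
  moreover have "0 < M * e" using M(1) e(1) by simp
  ultimately have "1 < 7 * (M * e)" by linarith
  then show False using e(3) M(1) by (simp add: field_simps)
qed

end

section \<open>Choosing the discs\<close>

text \<open>\<open>\<delta>\<close> is a certified distance of the circle from the segment and from the outer circle.\<close>

definition admissible :: "complex \<Rightarrow> real \<Rightarrow> real \<Rightarrow> bool" where
  "admissible q s \<delta> \<longleftrightarrow> 0 < s \<and> 0 < \<delta> \<and> norm q + s + \<delta> \<le> 2 \<and>
     (\<forall>t\<in>{0..1}. \<delta> \<le> \<bar>norm (complex_of_real t - q) - s\<bar>)"

text \<open>Countably many rational data suffice, and enumerating them through the first component
  of \<open>prod_decode\<close> repeats each one infinitely often.\<close>

lemma admissible_sequence:
  obtains q :: "nat \<Rightarrow> complex" and s \<delta> :: "nat \<Rightarrow> real"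
  where "\<And>m. admissible (q m) (s m) (\<delta> m)"
    and "\<And>n. \<exists>m\<ge>n. q m = 0 \<and> s m = 3 / 2"
    and "\<And>x \<epsilon>. 0 < \<epsilon> \<Longrightarrow> norm x + \<epsilon> \<le> 2 \<Longrightarrow> (\<And>t. t \<in> {0..1} \<Longrightarrow> \<epsilon> \<le> norm (x - complex_of_real t)) \<Longrightarrow>
      \<exists>Q S. norm (Q - x) < \<epsilon> / 16 \<and> \<epsilon> / 4 < S \<and> S < \<epsilon> / 3 \<and> (\<forall>n. \<exists>m\<ge>n. q m = Q \<and> s m = S)"
proof -
  obtain D :: "complex set" where D: "countable D" "\<And>X. open X \<Longrightarrow> X \<noteq> {} \<Longrightarrow> \<exists>d\<in>D. d \<in> X"
    using countable_dense_exists[where 'a=complex] by blast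
  define V where "V = {(Q, S, d). Q \<in> insert 0 D \<and> S \<in> \<rat> \<and> d \<in> \<rat> \<and> admissible Q S d}"
  have "countable V"
  proof (rule countable_subset)
    show "V \<subseteq> insert 0 D \<times> \<rat> \<times> \<rat>" unfolding V_def by blast
    show "countable (insert 0 D \<times> (\<rat> :: real set) \<times> (\<rat> :: real set))"
      by (intro countable_SIGMA countable_insert D(1) countable_rat)
  qed
  \<comment> \<open>This circle encloses the segment. It will confine the Jensen measures of segment
    points to norm below 7/4, where small circles still fit around the points.\<close>
  have V0: "(0, 3/2, 1/2) \<in> V"
    by (auto simp: V_def admissible_def abs_if)
  define v where "v m = from_nat_into V (fst (prod_decode m))" for m
  have v: "v m \<in> V" for m using V0 from_nat_into[of V] unfolding v_def by blast
  have v_inf: "\<exists>m\<ge>n. v m = x" if "x \<in> V" for x n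
  proof -
    have "\<exists>i. from_nat_into V i = x" using from_nat_into_surj[OF \<open>countable V\<close> that] .
    then obtain i where i: "from_nat_into V i = x" by blast
    show ?thesis by (rule exI[of _ "prod_encode (i, n)"]) (simp add: v_def i le_prod_encode_2)
  qed
  define q where "q m = fst (v m)" for m
  define s where "s m = fst (snd (v m))" for m
  define \<delta> where "\<delta> m = snd (snd (v m))" for m
  show ?thesis
  proof (rule that[of q s \<delta>])
    show "admissible (q m) (s m) (\<delta> m)" for m using v[of m] by (auto simp: V_def q_def s_def \<delta>_def)
    show "\<exists>m\<ge>n. q m = 0 \<and> s m = 3 / 2" for n
    proof -
      obtain m where "n \<le> m" "v m = (0, 3/2, 1/2)" using v_inf[OF V0, of n] by blast
      then show ?thesis by (intro exI[of _ m]) (simp add: q_def s_def)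
    qed
    show "\<exists>Q S. norm (Q - x) < \<epsilon> / 16 \<and> \<epsilon> / 4 < S \<and> S < \<epsilon> / 3 \<and> (\<forall>n. \<exists>m\<ge>n. q m = Q \<and> s m = S)"
      if \<epsilon>: "0 < \<epsilon>" "norm x + \<epsilon> \<le> 2" and I: "\<And>t. t \<in> {0..1} \<Longrightarrow> \<epsilon> \<le> norm (x - complex_of_real t)" for x \<epsilon>
    proof -
      \<comment> \<open>With these fractions x lies within S/4 of the centre Q, even the disc of
        radius 2S about Q fits into \<open>ball x \<epsilon>\<close>, and there is room for a margin
        d below \<epsilon>/8.\<close>
      obtain Q where Q: "Q \<in> D" "Q \<in> ball x (\<epsilon> / 16)" using D(2)[of "ball x (\<epsilon> / 16)"] \<epsilon> by auto
      then have Qx: "norm (Q - x) < \<epsilon> / 16" by (auto simp: dist_norm norm_minus_commute)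
      obtain S where S: "S \<in> \<rat>" "\<epsilon> / 4 < S" "S < \<epsilon> / 3" using Rats_dense_in_real[of "\<epsilon>/4" "\<epsilon>/3"] \<epsilon> by auto
      obtain d where d: "d \<in> \<rat>" "0 < d" "d < \<epsilon> / 8" using Rats_dense_in_real[of 0 "\<epsilon>/8"] \<epsilon> by auto
      have "norm Q \<le> norm x + norm (Q - x)" by (rule norm_triangle_sub)
      then have 1: "norm Q + S + d \<le> 2" using Qx S d \<epsilon> by linarith
      have "d \<le> \<bar>norm (complex_of_real t - Q) - S\<bar>" if "t \<in> {0..1}" for t
      proof -
        have "norm (x - complex_of_real t) \<le> norm (complex_of_real t - Q) + norm (Q - x)"
          using norm_triangle_ineq4[of "- (complex_of_real t - Q)" "Q - x"] by (simp add: norm_minus_commute)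
        then show ?thesis using I[OF that] Qx S d by linarith
      qed
      then have "(Q, S, d) \<in> V" using Q S d 1 by (auto simp: V_def admissible_def)
      then have "\<exists>m\<ge>n. v m = (Q, S, d)" for n by (rule v_inf)
      then have "\<forall>n. \<exists>m\<ge>n. q m = Q \<and> s m = S" unfolding q_def s_def by (metis fst_conv snd_conv)
      then show ?thesis using Qx S by blast
    qed
  qed
qed

text \<open>For fixed m, \<open>n * exp (- n / (m + 1))\<close> tends to 0, so the numbers can be
  chosen one after the other, each aware of its predecessor. The last property compares consecutive
  stages and feeds \<open>generic_radius\<close>.\<close>

lemma rapidly_decreasing_sequence:
  fixes \<beta> :: "nat \<Rightarrow> real"
  assumes \<beta>: "\<And>m. 0 < \<beta> m"
  obtains N :: "nat \<Rightarrow> nat" where "\<And>m. 2 \<le> N m" "\<And>m. m \<le> N m"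
    "\<And>m. real (N m) * exp (- real (N m) / (real m + 1)) \<le> \<beta> m"
    "\<And>m. 32 * real (N m) * (real (N (Suc m)) * exp (- real (N (Suc m)) / (real (Suc m) + 1))) \<le> exp (- real (N m) / (real m + 1))"
proof -
  have ex: "\<exists>n. 2 \<le> n \<and> m \<le> n \<and> real n * exp (- real n / (real m + 1)) \<le> b" if "0 < b" for b :: real and m :: nat
  proof -
    have a: "0 < real m + 1" by simp
    have "((\<lambda>n. real n * exp (- real n / (real m + 1))) \<longlongrightarrow> 0) at_top" using a by real_asymp
    then have "eventually (\<lambda>n. real n * exp (- real n / (real m + 1)) < b) at_top"
      using that by (rule order_tendstoD(2))
    then have "eventually (\<lambda>n. 2 \<le> n \<and> m \<le> n \<and> real n * exp (- real n / (real m + 1)) < b) at_top"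
      by (intro eventually_conj eventually_ge_at_top)
    then show ?thesis by (auto simp: eventually_at_top_linorder intro: less_imp_le)
  qed
  have "\<exists>N. \<forall>m. (2 \<le> N m \<and> m \<le> N m \<and> real (N m) * exp (- real (N m) / (real m + 1)) \<le> \<beta> m) \<and>
      32 * real (N m) * (real (N (Suc m)) * exp (- real (N (Suc m)) / (real (Suc m) + 1))) \<le> exp (- real (N m) / (real m + 1))"
  proof (rule dependent_nat_choice)
    show "\<exists>n. 2 \<le> n \<and> 0 \<le> n \<and> real n * exp (- real n / (real 0 + 1)) \<le> \<beta> 0"
      using ex[OF \<beta>[of 0], of 0] .
    fix x m :: nat assume x: "2 \<le> x \<and> m \<le> x \<and> real x * exp (- real x / (real m + 1)) \<le> \<beta> m"
    define b where "b = min (\<beta> (Suc m)) (exp (- real x / (real m + 1)) / (32 * x))"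
    have "0 < b" using \<beta>[of "Suc m"] x by (auto simp: b_def)
    then obtain n where n: "2 \<le> n" "Suc m \<le> n" "real n * exp (- real n / (real (Suc m) + 1)) \<le> b" using ex by blast
    then have "real n * exp (- real n / (real (Suc m) + 1)) \<le> \<beta> (Suc m)"
      "real n * exp (- real n / (real (Suc m) + 1)) \<le> exp (- real x / (real m + 1)) / (32 * x)" by (auto simp: b_def)
    then show "\<exists>y. (2 \<le> y \<and> Suc m \<le> y \<and> real y * exp (- real y / (real (Suc m) + 1)) \<le> \<beta> (Suc m)) \<and>
        32 * real x * (real y * exp (- real y / (real (Suc m) + 1))) \<le> exp (- real x / (real m + 1))"
      using n(1,2) x by (intro exI[of _ n]) (simp add: field_simps)
  qed
  then obtain N :: "nat \<Rightarrow> nat" where N: "\<And>m. (2 \<le> N m \<and> m \<le> N m \<and> real (N m) * exp (- real (N m) / (real m + 1)) \<le> \<beta> m) \<and>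
      32 * real (N m) * (real (N (Suc m)) * exp (- real (N (Suc m)) / (real (Suc m) + 1))) \<le> exp (- real (N m) / (real m + 1))" by blast
  show ?thesis by (rule that[of N]) (use N in blast)+
qed

text \<open>Forbidden intervals of total length below b - a cannot cover [a, b], by subadditivity of
  Lebesgue measure.\<close>

lemma avoid_small_intervals:
  fixes J :: "nat \<Rightarrow> real set" and w B :: "nat \<Rightarrow> real"
  assumes fin: "\<And>i. finite (J i)" and w: "\<And>i. 0 \<le> w i" and B: "\<And>i. card (J i) * (2 * w i) \<le> B i" "summable B" "suminf B < b - a"
  shows "\<exists>x\<in>{a..b}. \<forall>i. \<forall>y\<in>J i. w i \<le> \<bar>y - x\<bar>"
proof (rule ccontr)
  assume neg: "\<not> ?thesis"
  define U where "U i = (\<Union>y\<in>J i. {y - w i<..<y + w i})" for i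
  have "{a..b} \<subseteq> (\<Union>i. U i)"
  proof
    fix x assume "x \<in> {a..b}"
    then have "\<exists>i. \<exists>y\<in>J i. \<bar>y - x\<bar> < w i" using neg by (auto simp: not_le)
    then obtain i y where "y \<in> J i" "\<bar>y - x\<bar> < w i" by blast
    then show "x \<in> (\<Union>i. U i)" by (auto simp: U_def abs_less_iff intro!: exI[of _ i] bexI[of _ y])
  qed
  moreover have U: "U i \<in> sets lborel" for i
    unfolding U_def using fin by (intro sets.finite_UN) auto
  ultimately have "emeasure lborel {a..b} \<le> emeasure lborel (\<Union>i. U i)"
    by (intro emeasure_mono sets.countable_UN) auto
  also have "\<dots> \<le> (\<Sum>i. emeasure lborel (U i))"
    using U by (intro emeasure_subadditive_countably) auto
  also have "\<dots> \<le> (\<Sum>i. ennreal (B i))"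
  proof (intro suminf_le)
    fix i
    have "emeasure lborel (U i) \<le> (\<Sum>y\<in>J i. emeasure lborel {y - w i<..<y + w i})"
      unfolding U_def using fin by (intro emeasure_subadditive_finite) auto
    also have "\<dots> = (\<Sum>y\<in>J i. ennreal (2 * w i))" using w by (intro sum.cong) auto
    also have "\<dots> = ennreal (card (J i) * (2 * w i))"
      using w[of i] by (simp add: ennreal_mult ennreal_of_nat_eq_real_of_nat)
    also have "\<dots> \<le> ennreal (B i)" using B(1) by (intro ennreal_leI)
    finally show "emeasure lborel (U i) \<le> ennreal (B i)" .
  qed auto
  also have "\<dots> = ennreal (suminf B)"
  proof (rule suminf_ennreal2)
    show "0 \<le> B i" for i using B(1)[of i] w[of i] by (meson mult_nonneg_nonneg of_nat_0_le_iff order_trans zero_le_numeral)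
  qed (rule B)
  finally have le: "emeasure lborel {a..b} \<le> ennreal (suminf B)" .
  have "0 \<le> B i" for i using B(1)[of i] w[of i] by (meson mult_nonneg_nonneg of_nat_0_le_iff order_trans zero_le_numeral)
  then have "0 \<le> suminf B" using suminf_nonneg[OF B(2)] by blast
  then show False using le B(3) by (simp add: ennreal_le_iff)
qed

text \<open>A pole of stage m and one of a later stage m' forbid an interval of length
  \<open>4 * \<rho> m'\<close> for R. By the factor 32 in \<open>dec\<close> the forbidden lengths
  sum to at most 4/31 of \<rho> m, less than the \<rho> m / 2 available, so one radius serves all
  discs of stage m.\<close>

lemma generic_radius:
  fixes P :: "nat \<Rightarrow> nat \<Rightarrow> complex" and \<rho> :: "nat \<Rightarrow> real" and N :: "nat \<Rightarrow> nat"
  assumes N: "\<And>m. 1 \<le> N m" and \<rho>: "\<And>m. 0 < \<rho> m" and dec: "\<And>m. 32 * N m * (N (Suc m) * \<rho> (Suc m)) \<le> \<rho> m"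
  shows "\<exists>R\<in>{\<rho> m / 2..\<rho> m}. \<forall>m'>m. \<forall>j<N m. \<forall>j'<N m'. 2 * \<rho> m' \<le> \<bar>norm (P m' j' - P m j) - R\<bar>"
proof -
  have bound: "N m * (N (Suc (m + i)) * \<rho> (Suc (m + i))) \<le> (1/32) ^ Suc i * \<rho> m" for i
  proof (induction i)
    case 0
    then show ?case using dec[of m] by simp
  next
    case (Suc i)
    define k where "k = Suc (m + i)"
    have "N (Suc k) * \<rho> (Suc k) * 1 \<le> N (Suc k) * \<rho> (Suc k) * N k"
      using N[of k] \<rho>[of "Suc k"] by (intro mult_left_mono) auto
    then have "32 * (N (Suc k) * \<rho> (Suc k)) \<le> \<rho> k" using dec[of k] by (simp add: mult_ac)
    also have "\<rho> k = \<rho> k * 1" by simp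
    also have "\<dots> \<le> \<rho> k * N k" using N[of k] \<rho>[of k] by (intro mult_left_mono) auto
    finally have "N (Suc k) * \<rho> (Suc k) \<le> (1/32) * (N k * \<rho> k)" by (simp add: mult_ac)
    then have "N m * (N (Suc k) * \<rho> (Suc k)) \<le> N m * ((1/32) * (N k * \<rho> k))" by (intro mult_left_mono) auto
    also have "\<dots> = (1/32) * (N m * (N k * \<rho> k))" by simp
    also have "\<dots> \<le> (1/32) * ((1/32) ^ Suc i * \<rho> m)" using Suc by (intro mult_left_mono) (auto simp: k_def)
    finally show ?case by (simp add: k_def mult_ac)
  qed
  define J where "J i = (\<lambda>(j, j'). norm (P (Suc (m + i)) j' - P m j)) ` ({..<N m} \<times> {..<N (Suc (m + i))})" for i
  define B where "B i = 4 * \<rho> m * (1/32) ^ Suc i" for i :: nat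
  have geo: "B sums (4 * \<rho> m * ((1/32) / (1 - 1/32)))"
    unfolding B_def using sums_mult[OF sums_mult[OF geometric_sums[of "1/32 :: real"], of "1/32"], of "4 * \<rho> m"]
    by simp
  have "\<exists>x\<in>{\<rho> m / 2..\<rho> m}. \<forall>i. \<forall>y\<in>J i. 2 * \<rho> (Suc (m + i)) \<le> \<bar>y - x\<bar>"
  proof (rule avoid_small_intervals[where B=B])
    show "finite (J i)" for i by (simp add: J_def)
    show "0 \<le> 2 * \<rho> (Suc (m + i))" for i using \<rho> by (simp add: less_imp_le)
    show "card (J i) * (2 * (2 * \<rho> (Suc (m + i)))) \<le> B i" for i
    proof -
      have "card (J i) \<le> N m * N (Suc (m + i))"
        unfolding J_def by (rule order_trans[OF card_image_le]) auto
      then have "real (card (J i)) \<le> real (N m * N (Suc (m + i)))" by (rule of_nat_mono)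
      then have "real (card (J i)) * (4 * \<rho> (Suc (m + i))) \<le> real (N m * N (Suc (m + i))) * (4 * \<rho> (Suc (m + i)))"
        using \<rho>[of "Suc (m + i)"] by (intro mult_right_mono) auto
      also have "\<dots> = 4 * (N m * (N (Suc (m + i)) * \<rho> (Suc (m + i))))" by simp
      also have "\<dots> \<le> 4 * ((1/32) ^ Suc i * \<rho> m)" using bound by (intro mult_left_mono) auto
      finally show ?thesis by (simp add: B_def mult_ac)
    qed
    show "summable B" using geo by (rule sums_summable)
    show "suminf B < \<rho> m - \<rho> m / 2" using sums_unique[OF geo] \<rho>[of m] by simp
  qed
  then obtain x where x: "x \<in> {\<rho> m / 2..\<rho> m}" "\<And>i y. y \<in> J i \<Longrightarrow> 2 * \<rho> (Suc (m + i)) \<le> \<bar>y - x\<bar>" by blast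
  show ?thesis
  proof (intro bexI[OF _ x(1)] allI impI)
    fix m' j j' assume *: "m < m'" "j < N m" "j' < N m'"
    then obtain i where "m' = Suc (m + i)" using less_imp_Suc_add by blast
    then show "2 * \<rho> m' \<le> \<bar>norm (P m' j' - P m j) - x\<bar>"
      using * by (auto intro!: x(2) image_eqI[of _ _ "(j, j')"] simp: J_def)
  qed
qed

text \<open>The powers of z sum to 0, so n is the sum of the differences 1 - z^k, each of norm at
  most n times that of 1 - z.\<close>

lemma root_of_unity_distance:
  fixes z :: complex
  assumes n: "0 < n" and "z ^ n = 1" "z \<noteq> 1" "norm z = 1"
  shows "1 \<le> n * norm (1 - z)"
proof -
  have "(\<Sum>k<n. z ^ k) = 0" using assms by (simp add: geometric_sum)
  then have "of_nat n = (\<Sum>k<n. 1 - z ^ k)" by (simp add: sum_subtractf)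
  then have "real n = norm (\<Sum>k<n. 1 - z ^ k)" by (metis norm_of_nat)
  also have "\<dots> \<le> (\<Sum>k<n. n * norm (1 - z))"
  proof (intro sum_norm_le)
    fix k assume k: "k \<in> {..<n}"
    have "norm (1 ^ k - z ^ k) \<le> k * norm (1 - z)" using assms by (intro norm_power_diff) auto
    also have "\<dots> \<le> n * norm (1 - z)" using k by (intro mult_right_mono) auto
    finally show "norm (1 - z ^ k) \<le> n * norm (1 - z)" by simp
  qed
  finally have "real n * 1 \<le> real n * (n * norm (1 - z))" by simp
  then show ?thesis using n by simp
qed

section \<open>The maximal discs and failure of regularity\<close>

definition radius_bound :: "(nat \<Rightarrow> nat) \<Rightarrow> nat \<Rightarrow> real" where
  "radius_bound N m = exp (- real (N m) / (real m + 1))"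

text \<open>Stage \<open>m\<close> removes discs around the \<open>N m\<close> equidistributed points \<open>pole m j\<close> of a circle.
  By \<open>sep\<close> any two discs are disjoint or nested, and \<open>A\<close> consists of the maximal ones.\<close>

locale root_discs =
  fixes q :: "nat \<Rightarrow> complex" and s \<delta> :: "nat \<Rightarrow> real" and N :: "nat \<Rightarrow> nat" and R d \<eta> :: "nat \<Rightarrow> real"
    and pole :: "nat \<Rightarrow> nat \<Rightarrow> complex" and \<rho> :: "nat \<Rightarrow> real"
  assumes pole_def: "pole = (\<lambda>m j. q m + of_real (s m) * cis (2 * pi * real j / real (N m)))"
    and \<rho>_def: "\<rho> = radius_bound N"
    and adm: "\<And>m. admissible (q m) (s m) (\<delta> m)"
    and N2: "\<And>m. 2 \<le> N m" and N_ge: "\<And>m. m \<le> N m"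
    and R: "\<And>m. \<rho> m / 2 \<le> R m" "\<And>m. R m \<le> \<rho> m"
    and sep: "\<And>m m' j j'. m < m' \<Longrightarrow> j < N m \<Longrightarrow> j' < N m' \<Longrightarrow>
      2 * \<rho> m' \<le> \<bar>norm (pole m' j' - pole m j) - R m\<bar>"
    and small_s: "\<And>m. N m * \<rho> m \<le> s m / 4"
    and small_\<delta>: "\<And>m. N m * \<rho> m \<le> \<delta> m / 4 * (1/2) ^ Suc m"
    and small_\<eta>: "\<And>m n. n < m \<Longrightarrow> N m * \<rho> m \<le> \<delta> m / 2 * (1/2) ^ Suc m * \<eta> n"
    and d: "\<And>n. 0 < d n" "\<And>n. d n \<le> 1/2" "\<And>n i. i \<le> n \<Longrightarrow> d n \<le> \<delta> i / 4"
    and prop_\<eta>: "\<And>n. propagates (d n) (1 / (real n + 1)) (\<eta> n)" and \<eta>_le: "\<And>n. \<eta> n \<le> 1 / (real n + 1)"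
begin

definition D :: "(nat \<times> nat) set" where "D = {(m, j). j < N m}"

definition c :: "nat \<times> nat \<Rightarrow> complex" where "c = (\<lambda>(m, j). pole m j)"

definition r :: "nat \<times> nat \<Rightarrow> real" where "r = (\<lambda>(m, j). R m)"

text \<open>Testing the centre against earlier stages is enough: by \<open>sep\<close> a later disc
  whose centre lies in an earlier one lies in it entirely, and discs of one stage are
  disjoint.\<close>

definition A :: "(nat \<times> nat) set" where
  "A = {k\<in>D. \<forall>l\<in>D. fst l < fst k \<longrightarrow> c k \<notin> ball (c l) (r l)}"

lemma s_pos: "0 < s m" and \<delta>_pos: "0 < \<delta> m" and q_bound: "norm (q m) + s m + \<delta> m \<le> 2"
  and seg_bound: "t \<in> {0..1} \<Longrightarrow> \<delta> m \<le> \<bar>norm (complex_of_real t - q m) - s m\<bar>"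
  using adm[of m] by (auto simp: admissible_def)

lemma \<rho>_pos: "0 < \<rho> m"
  by (simp add: \<rho>_def radius_bound_def)

lemma R_pos: "0 < R m"
  using R(1)[of m] \<rho>_pos[of m] by linarith

lemma \<rho>_le: "\<rho> m \<le> N m * \<rho> m"
  using N2[of m] \<rho>_pos[of m] by simp

lemma \<rho>_le_\<delta>: "\<rho> m \<le> \<delta> m / 4"
proof -
  have "\<delta> m / 4 * (1/2) ^ Suc m \<le> \<delta> m / 4 * 1"
    using \<delta>_pos[of m] by (intro mult_left_mono power_le_one) auto
  then show ?thesis using \<rho>_le[of m] small_\<delta>[of m] by linarith
qed

lemma norm_pole: "norm (pole m j - q m) = s m"
  using s_pos[of m] by (simp add: pole_def norm_mult)

lemma pole_cball_subset: "cball (pole m j) (R m) \<subseteq> ball 0 2"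
proof
  fix w assume "w \<in> cball (pole m j) (R m)"
  then have w: "norm (w - pole m j) \<le> R m" by (simp add: dist_norm norm_minus_commute)
  have "norm w \<le> norm (q m) + norm (pole m j - q m) + norm (w - pole m j)"
    using norm_triangle_sub[of w "pole m j"] norm_triangle_sub[of "pole m j" "q m"] by simp
  then show "w \<in> ball 0 2" using w norm_pole[of m j] q_bound[of m] R(2)[of m] \<rho>_le_\<delta>[of m] \<delta>_pos[of m] by simp
qed

lemma pole_cball_far:
  assumes "w \<in> cball (pole m j) (R m)" "t \<in> {0..1}"
  shows "\<delta> m / 2 \<le> norm (w - complex_of_real t)"
proof -
  have w: "norm (w - pole m j) \<le> R m" using assms(1) by (simp add: dist_norm norm_minus_commute)
  have "\<bar>norm (complex_of_real t - q m) - norm (pole m j - q m)\<bar> \<le> norm (complex_of_real t - pole m j)"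
    using norm_triangle_ineq3[of "complex_of_real t - q m" "pole m j - q m"] by simp
  moreover have "norm (complex_of_real t - pole m j) \<le> norm (w - complex_of_real t) + norm (w - pole m j)"
    using norm_triangle_ineq4[of "w - pole m j" "w - complex_of_real t"] by simp
  ultimately show ?thesis using w seg_bound[OF assms(2), of m] norm_pole[of m j] R(2)[of m] \<rho>_le_\<delta>[of m] \<delta>_pos[of m] by linarith
qed

text \<open>Distinct roots of unity are at least 1/N apart, hence poles at least s/N, whereas
  \<open>small_s\<close> limits 2R to s/(2N).\<close>

lemma same_stage_distance:
  assumes "i < N m" "j < N m" "i \<noteq> j"
  shows "2 * R m < norm (pole m i - pole m j)"
proof -
  define x y where "x = cis (2 * pi * real i / real (N m))" and "y = cis (2 * pi * real j / real (N m))"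
  have N: "0 < N m" using N2[of m] by linarith
  have "x \<noteq> y"
    using bij_betw_imp_inj_on[OF Complex.bij_betw_roots_unity[OF N]] assms by (auto simp: x_def y_def dest: inj_onD)
  have roots: "x ^ N m = 1" "y ^ N m = 1" "norm x = 1" "norm y = 1"
    using bij_betwE[OF Complex.bij_betw_roots_unity[OF N]] assms by (auto simp: x_def y_def)
  define z where "z = y / x"
  have "x \<noteq> 0" using roots by auto
  then have "norm (1 - z) = norm (x - y)"
  proof -
    have "1 - z = (x - y) / x" using \<open>x \<noteq> 0\<close> by (simp add: z_def diff_divide_distrib)
    then show ?thesis using roots by (simp add: norm_divide)
  qed
  moreover have "1 \<le> N m * norm (1 - z)"
    using \<open>x \<noteq> y\<close> \<open>x \<noteq> 0\<close> roots N
    by (intro root_of_unity_distance) (auto simp: z_def power_divide norm_divide)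
  ultimately have "1 \<le> N m * norm (x - y)" by simp
  then have "s m * 1 \<le> s m * (N m * norm (x - y))" using s_pos[of m] by (intro mult_left_mono) auto
  also have "s m * norm (x - y) = norm (pole m i - pole m j)"
    using s_pos[of m] by (simp add: pole_def x_def y_def norm_mult flip: right_diff_distrib)
  then have "s m * (N m * norm (x - y)) = N m * norm (pole m i - pole m j)" by simp
  finally have "s m \<le> N m * norm (pole m i - pole m j)" by simp
  moreover have "N m * (2 * R m) \<le> N m * (2 * \<rho> m)" using R(2) by (intro mult_left_mono) auto
  moreover have "N m * (2 * \<rho> m) = 2 * (N m * \<rho> m)" by simp
  ultimately have "N m * (2 * R m) < N m * norm (pole m i - pole m j)"
    using small_s[of m] s_pos[of m] by linarith
  then show ?thesis using N by simp
qed

text \<open>For different stages the later centre lies outside the earlier disc, and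
  \<open>sep\<close> turns this into a gap of at least \<open>2 * \<rho>\<close>, which exceeds the
  later radius.\<close>

lemma discs_disjoint:
  assumes k: "k \<in> A" and l: "l \<in> A" and "k \<noteq> l"
  shows "cball (c k) (r k) \<inter> cball (c l) (r l) = {}"
proof -
  have *: "r k + r l < dist (c k) (c l)" if kl: "k \<in> A" "l \<in> A" "k \<noteq> l" "fst k \<le> fst l" for k l
  proof (cases "fst k = fst l")
    case True
    then show ?thesis using kl same_stage_distance[of "snd k" "fst k" "snd l"]
      by (cases k; cases l) (auto simp: A_def D_def c_def r_def dist_norm)
  next
    case False
    then have less: "fst k < fst l" using kl by simp
    have "c l \<notin> ball (c k) (r k)" using kl less by (auto simp: A_def)
    moreover have "2 * \<rho> (fst l) \<le> \<bar>norm (c l - c k) - r k\<bar>"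
      using kl less sep[of "fst k" "fst l" "snd k" "snd l"] by (cases k; cases l) (auto simp: A_def D_def c_def r_def)
    moreover have "r l \<le> \<rho> (fst l)" "0 < \<rho> (fst l)" using R(2) \<rho>_pos by (auto simp: r_def split: prod.split)
    ultimately show ?thesis by (simp add: dist_norm norm_minus_commute)
  qed
  have "r k + r l < dist (c k) (c l)"
    using *[OF k l \<open>k \<noteq> l\<close>] *[OF l k] \<open>k \<noteq> l\<close> by (cases "fst k \<le> fst l") (auto simp: dist_commute add.commute)
  then have "\<not> (dist (c k) w \<le> r k \<and> dist (c l) w \<le> r l)" for w
    using dist_triangle2[of "c k" "c l" w] by linarith
  then show ?thesis by (auto simp: disjoint_iff)
qed

text \<open>Descent on the stage: a disc left out of A lies in a disc of an earlier stage.\<close>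

lemma disc_in_maximal_disc: "k \<in> D \<Longrightarrow> \<exists>l\<in>A. ball (c k) (r k) \<subseteq> ball (c l) (r l)"
proof (induction "fst k" arbitrary: k rule: less_induct)
  case less
  show ?case
  proof (cases "k \<in> A")
    case False
    then obtain l where l: "l \<in> D" "fst l < fst k" "c k \<in> ball (c l) (r l)" using less.prems by (auto simp: A_def)
    have "2 * \<rho> (fst k) \<le> \<bar>norm (c k - c l) - r l\<bar>"
      using l less.prems sep[of "fst l" "fst k" "snd l" "snd k"] by (cases k; cases l) (auto simp: D_def c_def r_def)
    moreover have "r k \<le> \<rho> (fst k)" "0 < \<rho> (fst k)" using R(2) \<rho>_pos by (auto simp: r_def split: prod.split)
    ultimately have near: "dist (c l) (c k) + r k < r l" using l(3) by (simp add: dist_norm norm_minus_commute)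
    have "ball (c k) (r k) \<subseteq> ball (c l) (r l)"
    proof
      fix w assume "w \<in> ball (c k) (r k)"
      then show "w \<in> ball (c l) (r l)" using near dist_triangle[of "c l" w "c k"] by simp
    qed
    then show ?thesis using less.hyps[OF l(2,1)] by blast
  qed blast
qed

text \<open>The budgets of the stages are geometric. With b = 1 this bounds the total radius, with b
  = \<open>\<eta> n\<close> the radii of later stages weighted by their distance from the
  segment.\<close>

lemma sum_over_discs:
  fixes v :: "nat \<Rightarrow> real"
  assumes v: "\<And>m. 0 \<le> v m" "\<And>m. N m * v m \<le> b * (1/2) ^ Suc m" and F: "finite F" "F \<subseteq> D"
  shows "(\<Sum>k\<in>F. v (fst k)) \<le> b"
proof -
  have "\<exists>M. \<forall>m\<in>fst ` F. m < M" using F finite_nat_set_iff_bounded[of "fst ` F"] by simp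
  then obtain M where M: "\<forall>m\<in>fst ` F. m < M" by blast
  have "(\<Sum>k\<in>F. v (fst k)) \<le> (\<Sum>k\<in>Sigma {..<M} (\<lambda>m. {..<N m}). v (fst k))"
    using F M v(1) by (intro sum_mono2) (auto simp: D_def)
  also have "\<dots> = (\<Sum>m<M. \<Sum>j<N m. v m)" by (subst sum.Sigma) (auto simp: case_prod_unfold)
  also have "\<dots> \<le> (\<Sum>m<M. b * (1/2) ^ Suc m)" using v(2) by (intro sum_mono) simp
  also have "\<dots> = b * (1 - (1/2) ^ M)"
    by (induction M) (simp_all add: algebra_simps)
  also have "\<dots> \<le> b * 1"
  proof (rule mult_left_mono)
    have "0 \<le> N 0 * v 0" using v(1) by simp
    then show "0 \<le> b" using v(2)[of 0] by simp
  qed auto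
  finally show ?thesis by simp
qed

sublocale disc_family A c r
proof
  show "0 < r k" for k using R_pos by (auto simp: r_def split: prod.split)
  show "cball (c k) (r k) \<subseteq> ball 0 2" for k using pole_cball_subset by (auto simp: r_def c_def split: prod.split)
  show "cball (c k) (r k) \<inter> cball (c l) (r l) = {}" if "k \<in> A" "l \<in> A" "k \<noteq> l" for k l
    using that by (rule discs_disjoint)
  show "sum r F \<le> 1" if "finite F" "F \<subseteq> A" for F
  proof -
    have "(\<Sum>k\<in>F. R (fst k)) \<le> 1"
    proof (rule sum_over_discs[where v=R and b=1])
      show "0 \<le> R m" for m using R_pos by (simp add: less_imp_le)
      show "N m * R m \<le> 1 * (1/2) ^ Suc m" for m
      proof -
        have "N m * R m \<le> N m * \<rho> m" using R(2) by (intro mult_left_mono) auto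
        also have "\<dots> \<le> \<delta> m / 4 * (1/2) ^ Suc m" by (rule small_\<delta>)
        also have "\<dots> \<le> 1 * (1/2) ^ Suc m"
          using q_bound[of m] s_pos[of m] norm_ge_zero[of "q m"] by (intro mult_right_mono) (linarith, simp)
        finally show ?thesis .
      qed
    qed (use that in \<open>auto simp: A_def\<close>)
    then show ?thesis by (simp add: r_def case_prod_unfold)
  qed
qed

lemma segment_not_in_discs: "t \<in> {0..1} \<Longrightarrow> complex_of_real t \<notin> cball (c k) (r k)"
  using pole_cball_far[of "complex_of_real t" "fst k" "snd k" t] \<delta>_pos[of "fst k"] by (auto simp: c_def r_def case_prod_unfold)

lemma segment_subset_cheese: "t \<in> {0..1} \<Longrightarrow> complex_of_real t \<in> cheese"
  using segment_not_in_discs ball_subset_cball unfolding cheese_def by fastforce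

text \<open>Even if the disc of this pole is not in A, a maximal disc contains it, so it has been
  removed.\<close>

lemma pole_not_near_cheese:
  assumes "z \<in> cheese" "j < N m"
  shows "\<rho> m / 2 \<le> norm (pole m j - z)"
proof -
  obtain l where "l \<in> A" "ball (c (m, j)) (r (m, j)) \<subseteq> ball (c l) (r l)"
    using disc_in_maximal_disc[of "(m, j)"] assms by (auto simp: D_def)
  then have "z \<notin> ball (c (m, j)) (r (m, j))" using assms(1) unfolding cheese_def by blast
  then have "z \<notin> ball (pole m j) (R m)" by (simp add: c_def r_def)
  then show ?thesis using R(1)[of m] by (simp add: dist_norm)
qed

lemma not_R_regular: "\<not> R_regular cheese"
proof (rule not_R_regular_cheese)
  fix e :: real assume "0 < e"
  then obtain n :: nat where n: "1 / (real n + 1) < e"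
    using reals_Archimedean[of e] by (auto simp: inverse_eq_divide add.commute)
  \<comment> \<open>Stages up to n are those from whose margins \<open>d n\<close> is taken; all
    later ones are small relative to \<open>\<eta> n\<close> by \<open>small_\<eta>\<close>.\<close>
  define B where "B = {k\<in>A. fst k \<le> n}"
  define S where "S k = \<delta> (fst k) / 2" for k :: "nat \<times> nat"
  have far: "S k \<le> norm (w - complex_of_real t)" if "w \<in> cball (c k) (r k)" "t \<in> {0..1}" for k w t
    using pole_cball_far[of w "fst k" "snd k" t] that by (simp add: S_def c_def r_def case_prod_unfold)
  have "propagates (d n) e (\<eta> n)"
    using prop_\<eta>[of n] n unfolding propagates_def by (meson less_imp_le order_trans)
  moreover have "\<eta> n \<le> e" using \<eta>_le[of n] n by linarith
  moreover have "2 * d n \<le> norm (w - complex_of_real t)" if "k \<in> B" "w \<in> cball (c k) (r k)" "t \<in> {0..1}" for k w t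
    using far[OF that(2,3)] d(3)[of "fst k" n] that(1) by (simp add: B_def S_def)
  moreover have "(\<Sum>k\<in>F. r k / S k) \<le> \<eta> n" if F: "finite F" "F \<subseteq> A - B" for F
  proof -
    define v where "v m = (if n < m then R m / (\<delta> m / 2) else 0)" for m
    have "(\<Sum>k\<in>F. v (fst k)) \<le> \<eta> n"
    proof (rule sum_over_discs[where v=v and b="\<eta> n"])
      show "0 \<le> v m" for m using R_pos[of m] \<delta>_pos[of m] by (simp add: v_def)
      show "N m * v m \<le> \<eta> n * (1/2) ^ Suc m" for m
      proof (cases "n < m")
        case True
        have "N m * R m \<le> N m * \<rho> m" using R(2) by (intro mult_left_mono) auto
        also have "\<dots> \<le> \<delta> m / 2 * (1/2) ^ Suc m * \<eta> n" using small_\<eta>[OF True] .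
        finally have "N m * R m \<le> (\<eta> n * (1/2) ^ Suc m) * (\<delta> m / 2)" by (simp add: mult_ac)
        then have "N m * R m / (\<delta> m / 2) \<le> \<eta> n * (1/2) ^ Suc m" using \<delta>_pos[of m] by (subst pos_divide_le_eq) auto
        then show ?thesis using True by (simp add: v_def)
      qed (use prop_\<eta>[of n] in \<open>simp add: v_def propagates_def\<close>)
    qed (use F in \<open>auto simp: A_def\<close>)
    also have "(\<Sum>k\<in>F. v (fst k)) = (\<Sum>k\<in>F. r k / S k)"
      using F by (intro sum.cong) (auto simp: v_def r_def S_def B_def subset_iff case_prod_unfold not_le)
    finally show ?thesis .
  qed
  ultimately show "\<exists>d \<eta> B s. 0 < d \<and> d \<le> 1/2 \<and> propagates d e \<eta> \<and> \<eta> \<le> e \<and> B \<subseteq> A \<and>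
      (\<forall>k\<in>B. \<forall>w\<in>cball (c k) (r k). \<forall>t\<in>{0..1}. 2 * d \<le> norm (w - complex_of_real t)) \<and>
      (\<forall>k\<in>A-B. 0 < s k \<and> (\<forall>w\<in>cball (c k) (r k). \<forall>t\<in>{0..1}. s k \<le> norm (w - complex_of_real t))) \<and>
      (\<forall>F. finite F \<longrightarrow> F \<subseteq> A - B \<longrightarrow> (\<Sum>k\<in>F. r k / s k) \<le> \<eta>)"
    using d(1,2)[of n] far \<delta>_pos
    by (intro exI[of _ "d n"] exI[of _ "\<eta> n"] exI[of _ B] exI[of _ S]) (auto simp: B_def S_def)
qed (use segment_not_in_discs in blast)

end

section \<open>Jensen measures\<close>

lemma elog_le: "0 \<le> t \<Longrightarrow> t \<le> exp a \<Longrightarrow> elog t \<le> ereal a"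
  using ln_le_cancel_iff[of t "exp a"] by (auto simp: elog_def)

lemma elog_ge: "exp a \<le> t \<Longrightarrow> ereal a \<le> elog t"
  using ln_le_cancel_iff[of "exp a" t] exp_gt_zero[of a] by (auto simp: elog_def simp del: exp_gt_zero)

text \<open>Jensen's inequality reads -e \<le> log |f(x)| \<le> a - b \<mu>(K): the positive part of
  log |f| is at most a, and the negative part is at least b on K. Treating the parts separately
  allows zeros of f. The bounds are only required almost everywhere because the peaking polynomial
  for the segment obeys them only there.\<close>

lemma jensen_estimate:
  assumes J: "jensen_measure X x \<mu>" and f: "f \<in> R_alg X" and K: "K \<in> sets \<mu>"
    and a: "AE y in \<mu>. norm (f y) \<le> exp a" "0 \<le> a"
    and b: "AE y in \<mu>. y \<in> K \<longrightarrow> norm (f y) \<le> exp (- b)" "0 \<le> b"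
    and e: "exp (- e) \<le> norm (f x)"
  shows "b * measure \<mu> K \<le> a + e"
proof -
  interpret prob_space \<mu> using J by (simp add: jensen_measure_def)
  let ?g = "\<lambda>y. elog (norm (f y))"
  have "(\<integral>\<^sup>+ y. e2ennreal (?g y) \<partial>\<mu>) \<le> (\<integral>\<^sup>+ y. ennreal a \<partial>\<mu>)"
    using a(1) by (intro nn_integral_mono_AE, eventually_elim) (metis e2ennreal_ereal e2ennreal_mono elog_le norm_ge_zero)
  also have "\<dots> = ennreal a" by (simp add: emeasure_space_1)
  finally have 1: "enn2ereal (\<integral>\<^sup>+ y. e2ennreal (?g y) \<partial>\<mu>) \<le> ereal a"
    using a(2) by (metis enn2ereal_ennreal less_eq_ennreal.rep_eq)
  have "ennreal b * emeasure \<mu> K = (\<integral>\<^sup>+ y. ennreal b * indicator K y \<partial>\<mu>)"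
    using K by (simp add: nn_integral_cmult_indicator)
  also have "\<dots> \<le> (\<integral>\<^sup>+ y. e2ennreal (- ?g y) \<partial>\<mu>)"
    using b(1)
  proof (intro nn_integral_mono_AE, eventually_elim)
    case (elim y)
    show ?case
    proof (cases "y \<in> K")
      case True
      then have "?g y \<le> ereal (- b)" using elim by (intro elog_le) auto
      then have "ereal b \<le> - ?g y" by (metis ereal_minus_le_minus ereal_uminus_uminus uminus_ereal.simps(1))
      then have "e2ennreal (ereal b) \<le> e2ennreal (- ?g y)" by (rule e2ennreal_mono)
      then show ?thesis using True by simp
    qed auto
  qed
  finally have "ennreal (b * measure \<mu> K) \<le> (\<integral>\<^sup>+ y. e2ennreal (- ?g y) \<partial>\<mu>)"
    using b(2) by (simp add: emeasure_eq_measure ennreal_mult)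
  then have 2: "ereal (b * measure \<mu> K) \<le> enn2ereal (\<integral>\<^sup>+ y. e2ennreal (- ?g y) \<partial>\<mu>)"
    using b(2) by (metis enn2ereal_ennreal less_eq_ennreal.rep_eq measure_nonneg mult_nonneg_nonneg)
  have "ereal (- e) \<le> ?g x" using e by (rule elog_ge)
  also have "\<dots> \<le> ereal_integral \<mu> ?g" using J f by (auto simp: jensen_measure_def)
  also have "\<dots> \<le> ereal a - ereal (b * measure \<mu> K)"
    unfolding ereal_integral_def using 1 2 by (rule ereal_minus_mono)
  finally show ?thesis by simp
qed

text \<open>\<open>jensen_estimate\<close> gives (M ln T - 1) \<mu>(K) \<le> 4 + M/(n+1). After
  division by M, where M \<ge> n, letting n grow leaves \<mu>(K) ln T \<le> 0.\<close>

lemma jensen_null_set: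
  assumes J: "jensen_measure X x \<mu>" and K: "K \<in> sets \<mu>" "K \<subseteq> X" and T: "1 < T"
    and ex: "\<And>n::nat. \<exists>f\<in>R_alg X. \<exists>M\<ge>n. (\<forall>y\<in>X. norm (f y) \<le> exp (3 + real M / (real n + 1))) \<and>
      (\<forall>y\<in>K. norm (f y) \<le> 1 / (T ^ M - 1)) \<and> 1 / 2 \<le> norm (f x)"
  shows "measure \<mu> K = 0"
proof (rule ccontr)
  assume "measure \<mu> K \<noteq> 0"
  interpret prob_space \<mu> using J by (simp add: jensen_measure_def)
  define \<kappa> where "\<kappa> = measure \<mu> K"
  have \<kappa>: "0 < \<kappa>" "\<kappa> \<le> 1" using \<open>measure \<mu> K \<noteq> 0\<close> by (auto simp: \<kappa>_def zero_less_measure_iff)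
  define l where "l = ln T"
  have l: "0 < l" using T by (simp add: l_def)
  \<comment> \<open>With n above n1 the term M/(n+1) uses up at most half of M \<kappa> l; above n2
    the other half exceeds 5, the remaining constants; above n3 the exponent M l is at least
    1.\<close>
  obtain n1 :: nat where n1: "2 / (\<kappa> * l) < real n1" using reals_Archimedean2 by blast
  obtain n2 :: nat where n2: "10 / (\<kappa> * l) < real n2" using reals_Archimedean2 by blast
  obtain n3 :: nat where n3: "1 / l < real n3" using reals_Archimedean2 by blast
  define n where "n = max n1 (max n2 n3)"
  obtain f M where f: "f \<in> R_alg X" and M: "n \<le> M" and bd: "\<And>y. y \<in> X \<Longrightarrow> norm (f y) \<le> exp (3 + real M / (real n + 1))"
    and small: "\<And>y. y \<in> K \<Longrightarrow> norm (f y) \<le> 1 / (T ^ M - 1)" and fx: "1 / 2 \<le> norm (f x)"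
    using ex[of n] by blast
  have TM: "T ^ M = exp (M * l)" using T by (simp add: l_def exp_of_nat_mult)
  have Ml: "1 \<le> M * l"
  proof -
    have "1 / l \<le> real M" using n3 M by (simp add: n_def)
    then show ?thesis using l by (simp add: field_simps)
  qed
  have e2: "2 \<le> exp (1::real)" using exp_ge_add_one_self[of "1::real"] by simp
  have "1 / (T ^ M - 1) \<le> exp (- (M * l - 1))"
  proof -
    have "2 \<le> exp (M * l)" using e2 Ml by (meson exp_le_cancel_iff order_trans)
    moreover have "1 * (exp (M * l) - 2) \<le> (exp 1 - 1) * (exp (M * l) - 2)"
      using e2 \<open>2 \<le> exp (M * l)\<close> by (intro mult_right_mono) auto
    ultimately have "exp (M * l) \<le> exp 1 * (exp (M * l) - 1)" using e2 by (simp add: algebra_simps)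
    moreover have "0 < exp (M * l) - 1" using \<open>2 \<le> exp (M * l)\<close> by linarith
    ultimately show ?thesis by (simp add: TM exp_diff pos_divide_le_eq pos_le_divide_eq mult.commute)
  qed
  then have small': "norm (f y) \<le> exp (- (M * l - 1))" if "y \<in> K" for y using small[OF that] by linarith
  have sp: "space \<mu> = X" using J by (simp add: jensen_measure_def)
  have "exp (- 1) \<le> (1/2::real)" using e2 by (simp add: exp_minus field_simps)
  then have "exp (- 1) \<le> norm (f x)" using fx by linarith
  then have "(M * l - 1) * \<kappa> \<le> (3 + real M / (real n + 1)) + 1"
    unfolding \<kappa>_def using bd small' Ml sp by (intro jensen_estimate[OF J f K(1)]) auto
  moreover have "real M / (real n + 1) \<le> M * (\<kappa> * l / 2)"
  proof -
    have "2 / (\<kappa> * l) \<le> real n + 1" using n1 by (simp add: n_def)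
    then have "1 / (real n + 1) \<le> \<kappa> * l / 2" using \<kappa> l by (simp add: field_simps)
    then have "real M * (1 / (real n + 1)) \<le> M * (\<kappa> * l / 2)" by (intro mult_left_mono) auto
    then show ?thesis by simp
  qed
  moreover have "(M * l - 1) * \<kappa> = M * (\<kappa> * l / 2) + M * (\<kappa> * l / 2) - \<kappa>" by (simp add: field_simps)
  ultimately have "M * (\<kappa> * l / 2) \<le> 5" using \<kappa> by linarith
  moreover have "10 / (\<kappa> * l) < real M" using n2 M by (simp add: n_def)
  then have "5 < M * (\<kappa> * l / 2)" using \<kappa> l by (simp add: field_simps)
  ultimately show False by simp
qed

lemma jensen_eq_return:
  assumes J: "jensen_measure X x \<mu>" and x: "x \<in> X"
    and null: "\<And>\<epsilon>. 0 < \<epsilon> \<Longrightarrow> AE y in \<mu>. norm (y - x) < \<epsilon>"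
  shows "\<mu> = return (restrict_space borel X) x"
proof -
  interpret prob_space \<mu> using J by (simp add: jensen_measure_def)
  have S: "sets \<mu> = sets (restrict_space borel X)" using J by (simp add: jensen_measure_def)
  have "AE y in \<mu>. \<forall>n::nat. norm (y - x) < 1 / (real n + 1)"
    unfolding AE_all_countable using null by simp
  then have AE: "AE y in \<mu>. y = x"
  proof eventually_elim
    case (elim y)
    have "\<not> 0 < norm (y - x)"
    proof
      assume "0 < norm (y - x)"
      then obtain n :: nat where "1 / (real n + 1) < norm (y - x)"
        using reals_Archimedean[of "norm (y - x)"] by (auto simp: inverse_eq_divide add.commute)
      then show False using elim[rule_format, of n] by simp
    qed
    then show ?case by simp
  qed
  show ?thesis
  proof (rule measure_eqI)
    show "sets \<mu> = sets (return (restrict_space borel X) x)" using S by simp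
    fix A assume A: "A \<in> sets \<mu>"
    have "emeasure \<mu> A = indicator A x"
    proof (cases "x \<in> A")
      case True
      then have "emeasure \<mu> A = emeasure \<mu> (space \<mu>)"
        using AE A by (intro emeasure_eq_AE) auto
      then show ?thesis using True by (simp add: emeasure_space_1)
    next
      case False
      then have "emeasure \<mu> A = emeasure \<mu> {}"
        using AE A by (intro emeasure_eq_AE) auto
      then show ?thesis using False by simp
    qed
    then show "emeasure \<mu> A = emeasure (return (restrict_space borel X) x) A"
      using A S by (simp add: emeasure_return)
  qed
qed

lemma closed_Int_in_sets_jensen:
  assumes "jensen_measure X x \<mu>" "closed C"
  shows "{y \<in> X. y \<in> C} \<in> sets \<mu>"
proof -
  have "X \<inter> C \<in> sets (restrict_space borel X)" using assms(2) by (simp add: sets_restrict_space)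
  moreover have "{y \<in> X. y \<in> C} = X \<inter> C" by auto
  ultimately show ?thesis using assms(1) by (simp add: jensen_measure_def)
qed

lemma poly_in_R_alg: "poly p \<in> R_alg X"
proof (rule rational_on_imp_R_alg)
  have "\<forall>z\<in>X. poly 1 z \<noteq> 0 \<and> poly p z = poly p z / poly 1 z" by simp
  then show "poly p \<in> rational_on X" unfolding rational_on_def by blast
qed

text \<open>Partial fractions of N/(1 - w^N): each term is a finite geometric series in w over the
  root, divided by 1 - w^N, and after summation over the roots only the power 0 survives.\<close>

lemma sum_roots_of_unity_fraction:
  fixes w :: complex
  assumes N: "0 < N" and w: "w ^ N \<noteq> 1"
  shows "(\<Sum>j<N. cis (2 * pi * real j / real N) / (cis (2 * pi * real j / real N) - w)) = of_nat N / (1 - w ^ N)"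
proof -
  define \<omega> where "\<omega> j = cis (2 * pi * real j / real N)" for j
  have roots: "\<omega> j ^ N = 1" if "j < N" for j
    using bij_betwE[OF Complex.bij_betw_roots_unity[OF N]] that by (auto simp: \<omega>_def)
  have frac: "\<omega> j / (\<omega> j - w) = (\<Sum>k<N. w ^ k * inverse (\<omega> j) ^ k) / (1 - w ^ N)" if "j < N" for j
  proof -
    have "\<omega> j \<noteq> w" using roots[OF that] w by auto
    define u where "u = w * inverse (\<omega> j)"
    have [simp]: "\<omega> j \<noteq> 0" by (simp add: \<omega>_def)
    have "u \<noteq> 1" using \<open>\<omega> j \<noteq> w\<close> by (simp add: u_def field_simps)
    have "(\<Sum>k<N. w ^ k * inverse (\<omega> j) ^ k) = (\<Sum>k<N. u ^ k)" by (simp add: u_def power_mult_distrib)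
    also have "\<dots> = (1 - u ^ N) / (1 - u)" using \<open>u \<noteq> 1\<close> by (simp add: sum_gp_strict)
    also have "u ^ N = w ^ N" using roots[OF that] by (simp add: u_def power_mult_distrib power_inverse)
    also have "1 - u = (\<omega> j - w) / \<omega> j" by (simp add: u_def field_simps)
    finally show ?thesis using w by simp
  qed
  have inner: "(\<Sum>j<N. inverse (\<omega> j) ^ k) = (if k = 0 then of_nat N else 0)" if "k < N" for k
  proof (cases "k = 0")
    case False
    define v where "v = inverse (\<omega> k)"
    have eq: "inverse (\<omega> j) ^ k = v ^ j" for j
      unfolding v_def \<omega>_def cis_inverse Complex.DeMoivre by (simp add: mult_ac)
    have "\<omega> k \<noteq> \<omega> 0"
      using bij_betw_imp_inj_on[OF Complex.bij_betw_roots_unity[OF N]] that False N unfolding \<omega>_def inj_on_def by blast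
    moreover have "\<omega> 0 = 1" by (simp add: \<omega>_def)
    ultimately have "v \<noteq> 1" unfolding v_def by (metis inverse_inverse_eq inverse_1)
    moreover have "v ^ N = 1" using roots[OF that] by (simp add: v_def power_inverse)
    ultimately show ?thesis using False by (simp add: eq sum_gp_strict)
  qed simp
  have "(\<Sum>j<N. \<omega> j / (\<omega> j - w)) = (\<Sum>j<N. \<Sum>k<N. w ^ k * inverse (\<omega> j) ^ k) / (1 - w ^ N)"
    using frac by (simp add: sum_divide_distrib)
  also have "(\<Sum>j<N. \<Sum>k<N. w ^ k * inverse (\<omega> j) ^ k) = (\<Sum>k<N. w ^ k * (\<Sum>j<N. inverse (\<omega> j) ^ k))"
    by (subst sum.swap) (simp add: sum_distrib_left)
  also have "\<dots> = (\<Sum>k<N. if k = 0 then of_nat N else 0)"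
    using inner by (intro sum.cong) auto
  also have "\<dots> = of_nat N" using N by simp
  finally show ?thesis by (simp add: \<omega>_def)
qed


section \<open>Kernels of the circles and the Jensen measures of the cheese\<close>

locale root_discs_dense = root_discs +
  assumes big_circle: "\<And>n. \<exists>m\<ge>n. q m = 0 \<and> s m = 3 / 2"
    and small_circle: "\<And>x \<epsilon>. 0 < \<epsilon> \<Longrightarrow> norm x + \<epsilon> \<le> 2 \<Longrightarrow>
      (\<And>t. t \<in> {0..1} \<Longrightarrow> \<epsilon> \<le> norm (x - complex_of_real t)) \<Longrightarrow>
      \<exists>Q S. norm (Q - x) < \<epsilon> / 16 \<and> \<epsilon> / 4 < S \<and> S < \<epsilon> / 3 \<and> (\<forall>n. \<exists>m\<ge>n. q m = Q \<and> s m = S)"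
begin

definition recurrent :: "complex \<Rightarrow> real \<Rightarrow> bool" where
  "recurrent Q S \<longleftrightarrow> (\<forall>n. \<exists>m\<ge>n. q m = Q \<and> s m = S)"

lemma discs_dense:
  assumes "p \<in> cheese" "0 < e"
  shows "\<exists>k\<in>A. ball p e \<inter> ball (c k) (r k) \<noteq> {}"
proof -
  have "p \<in> closure (ball 0 2)" using assms(1) by (simp add: cheese_def)
  moreover have "p \<in> ball p e" using assms(2) by simp
  ultimately have "ball p e \<inter> closure (ball 0 2) \<noteq> {}" by blast
  then have "ball p e \<inter> ball 0 2 \<noteq> {}"
    unfolding open_Int_closure_eq_empty[OF open_ball] .
  then obtain u where "u \<in> ball p e \<inter> ball 0 2" by blast
  moreover have "open (ball p e \<inter> ball (0::complex) 2)" by auto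
  ultimately obtain \<tau> where \<tau>: "0 < \<tau>" "ball u \<tau> \<subseteq> ball p e \<inter> ball 0 2" by (meson openE)
  \<comment> \<open>Off the real axis the segment is at distance at least |Im x|, so a small circle
    about x is available; its pole of index 0 is then close to p.\<close>
  define x where "x = (if Im u = 0 then u + \<i> * of_real (\<tau> / 2) else u)"
  have "x \<in> ball u \<tau>" using \<tau>(1) by (auto simp: x_def dist_norm norm_mult)
  then have x: "norm x < 2" "dist p x < e" using \<tau>(2) by auto
  have Im: "Im x \<noteq> 0" using \<tau>(1) by (auto simp: x_def)
  define \<epsilon> where "\<epsilon> = min \<bar>Im x\<bar> (min (2 - norm x) (e - dist p x))"
  have \<epsilon>: "0 < \<epsilon>" "norm x + \<epsilon> \<le> 2" "dist p x + \<epsilon> \<le> e" "\<epsilon> \<le> \<bar>Im x\<bar>" using x Im by (auto simp: \<epsilon>_def)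
  have "\<epsilon> \<le> norm (x - complex_of_real t)" for t
    using \<epsilon>(4) abs_Im_le_cmod[of "x - complex_of_real t"] by simp
  then obtain Q S where QS: "norm (Q - x) < \<epsilon> / 16" "\<epsilon> / 4 < S" "S < \<epsilon> / 3" "\<forall>n. \<exists>m\<ge>n. q m = Q \<and> s m = S"
    using small_circle[OF \<epsilon>(1,2)] by blast
  then obtain m where m: "q m = Q" "s m = S" by blast
  have "norm (pole m 0 - x) \<le> norm (pole m 0 - Q) + norm (Q - x)"
    using norm_triangle_ineq[of "pole m 0 - Q" "Q - x"] by simp
  then have "norm (pole m 0 - x) < \<epsilon>" using norm_pole[of m 0] m QS by simp
  then have "pole m 0 \<in> ball p e" using \<epsilon>(3) dist_triangle[of p "pole m 0" x] by (simp add: dist_norm norm_minus_commute)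
  moreover obtain l where l: "l \<in> A" "ball (c (m, 0)) (r (m, 0)) \<subseteq> ball (c l) (r l)"
    using disc_in_maximal_disc[of "(m, 0)"] N2[of m] by (auto simp: D_def)
  moreover have "pole m 0 \<in> ball (c (m, 0)) (r (m, 0))" using R_pos[of m] by (simp add: c_def r_def)
  ultimately show ?thesis by blast
qed

lemma essential: "R_essential cheese"
  using discs_dense segment_not_in_discs[of 0] by (intro R_essential_cheese[of 0]) auto

definition kernel :: "nat \<Rightarrow> complex \<Rightarrow> complex" where
  "kernel m z = 1 / (1 - ((z - q m) / s m) ^ N m)"

lemma kernel_pole:
  assumes "z \<in> cheese"
  shows "((z - q m) / s m) ^ N m \<noteq> 1"
proof
  assume *: "((z - q m) / s m) ^ N m = 1"
  have N: "0 < N m" using N2[of m] by simp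
  have "(z - q m) / s m \<in> (\<lambda>j. cis (2 * pi * real j / real (N m))) ` {..<N m}"
    using bij_betw_imp_surj_on[OF Complex.bij_betw_roots_unity[OF N]] * by auto
  then obtain j where j: "j < N m" "(z - q m) / s m = cis (2 * pi * real j / real (N m))" by blast
  then have "z = pole m j" using s_pos[of m] by (simp add: pole_def field_simps)
  then show False using pole_not_near_cheese[OF assms j(1)] \<rho>_pos[of m] by simp
qed

lemma kernel_rational: "kernel m \<in> rational_on cheese" "(\<lambda>z. 1 - kernel m z) \<in> rational_on cheese"
proof -
  define p where "p = [:- q m / s m, 1 / s m:] ^ N m"
  have p: "poly p z = ((z - q m) / s m) ^ N m" for z
    by (simp add: p_def diff_divide_distrib)
  have "\<forall>z\<in>cheese. poly (1 - p) z \<noteq> 0 \<and> kernel m z = poly 1 z / poly (1 - p) z"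
    using kernel_pole by (auto simp: p kernel_def)
  then show "kernel m \<in> rational_on cheese" unfolding rational_on_def by blast
  have "\<forall>z\<in>cheese. poly (1 - p) z \<noteq> 0 \<and> 1 - kernel m z = poly (- p) z / poly (1 - p) z"
    using kernel_pole by (auto simp: p kernel_def field_simps)
  then show "(\<lambda>z. 1 - kernel m z) \<in> rational_on cheese" unfolding rational_on_def by blast
qed

text \<open>The kernel is the average of N partial fractions, each at most s / (\<rho>/2) since the
  poles keep distance \<rho>/2 from the cheese. Averaging loses no factor N, and s \<le> 2.\<close>

lemma kernel_bound:
  assumes "z \<in> cheese"
  shows "norm (kernel m z) \<le> 4 * exp (N m / (real m + 1))"
proof -
  have N: "0 < N m" using N2[of m] by simp
  define w where "w = (z - q m) / s m"
  define \<omega> where "\<omega> j = cis (2 * pi * real j / real (N m))" for j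
  have w: "w ^ N m \<noteq> 1" using kernel_pole[OF assms, of m] by (simp add: w_def)
  have bnd: "norm (\<omega> j / (\<omega> j - w)) \<le> s m / (\<rho> m / 2)" if "j < N m" for j
  proof -
    have "\<omega> j - w = (pole m j - z) / s m" using s_pos[of m] by (simp add: w_def \<omega>_def pole_def field_simps)
    then have "norm (\<omega> j / (\<omega> j - w)) = s m / norm (pole m j - z)"
      using s_pos[of m] by (simp add: norm_divide norm_mult) (simp add: \<omega>_def)
    also have "\<dots> \<le> s m / (\<rho> m / 2)"
      using pole_not_near_cheese[OF assms that] \<rho>_pos[of m] s_pos[of m] by (intro frac_le) auto
    finally show ?thesis .
  qed
  have "of_nat (N m) * kernel m z = (\<Sum>j<N m. \<omega> j / (\<omega> j - w))"
    using sum_roots_of_unity_fraction[OF N w] by (simp add: kernel_def w_def \<omega>_def)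
  then have "N m * norm (kernel m z) = norm (\<Sum>j<N m. \<omega> j / (\<omega> j - w))" by (metis norm_mult norm_of_nat)
  also have "\<dots> \<le> (\<Sum>j<N m. s m / (\<rho> m / 2))" using bnd by (intro sum_norm_le) auto
  also have "\<dots> = N m * (s m / (\<rho> m / 2))" by simp
  finally have "norm (kernel m z) \<le> s m / (\<rho> m / 2)"
    by (rule mult_left_le_imp_le) (use N in simp)
  also have "\<dots> \<le> 2 / (\<rho> m / 2)"
  proof (rule divide_right_mono)
    show "s m \<le> 2" using q_bound[of m] \<delta>_pos[of m] norm_ge_zero[of "q m"] by linarith
  qed (use \<rho>_pos[of m] in simp)
  also have "\<dots> = 4 * exp (N m / (real m + 1))"
    by (simp add: \<rho>_def radius_bound_def exp_minus field_simps)
  finally show ?thesis .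
qed

text \<open>The summand 1 lets one bound serve both \<open>kernel\<close> and 1 -
  \<open>kernel\<close>; exp 3 \<ge> 8 absorbs the constants.\<close>

lemma four_exp_le:
  assumes "n \<le> m"
  shows "1 + 4 * exp (N m / (real m + 1)) \<le> exp (3 + N m / (real n + 1))"
proof -
  have e2: "2 \<le> exp (1::real)" using exp_ge_add_one_self[of "1::real"] by simp
  have "1 \<le> exp (N m / (real m + 1))" by simp
  moreover have "exp (N m / (real m + 1)) \<le> exp (N m / (real n + 1))"
    using assms by (simp add: frac_le)
  moreover have "5 * exp (N m / (real n + 1)) \<le> exp 3 * exp (N m / (real n + 1))"
  proof (rule mult_right_mono)
    have "(2::real) ^ 3 \<le> exp 1 ^ 3" using e2 by (intro power_mono) auto
    then show "5 \<le> exp (3::real)" by (simp flip: exp_of_nat_mult)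
  qed simp
  ultimately show ?thesis unfolding exp_add by linarith
qed

text \<open>Beyond T * S the power w^N has norm at least T^N, while |1 - w^N| \<le> 2 at x. The
  latter only takes |w| \<le> 1, so x may lie on the circle; the gap between S and T * S provides
  the exponential rate.\<close>

lemma null_outside_circle:
  assumes J: "jensen_measure cheese x \<mu>" and x: "norm (x - Q) \<le> S" "x \<in> cheese" and QS: "recurrent Q S" and T: "1 < T"
  shows "AE y in \<mu>. norm (y - Q) < T * S"
proof -
  interpret prob_space \<mu> using J by (simp add: jensen_measure_def)
  have sp: "space \<mu> = cheese" using J by (simp add: jensen_measure_def)
  define K where "K = {y \<in> cheese. y \<in> {y. T * S \<le> norm (y - Q)}}"
  have K: "K \<in> sets \<mu>"
    unfolding K_def by (intro closed_Int_in_sets_jensen[OF J] closed_Collect_le continuous_intros)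
  have "measure \<mu> K = 0"
  proof (rule jensen_null_set[OF J K _ T])
    fix n
    obtain m where m: "n \<le> m" "q m = Q" "s m = S" using QS unfolding recurrent_def by blast
    have S: "0 < S" using s_pos[of m] m by simp
    have N: "0 < N m" using N2[of m] by simp
    define w where "w y = (y - Q) / S" for y :: complex
    have kern: "kernel m y = 1 / (1 - w y ^ N m)" for y by (simp add: kernel_def w_def m)
    show "\<exists>f\<in>R_alg cheese. \<exists>M\<ge>n. (\<forall>y\<in>cheese. norm (f y) \<le> exp (3 + real M / (real n + 1))) \<and>
        (\<forall>y\<in>K. norm (f y) \<le> 1 / (T ^ M - 1)) \<and> 1 / 2 \<le> norm (f x)"
    proof (intro bexI[of _ "kernel m"] exI[of _ "N m"] conjI ballI)
      show "kernel m \<in> R_alg cheese" using kernel_rational rational_on_imp_R_alg by blast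
      show "n \<le> N m" using N_ge[of m] m by simp
      show "norm (kernel m y) \<le> exp (3 + real (N m) / (real n + 1))" if "y \<in> cheese" for y
        using kernel_bound[OF that, of m] four_exp_le[OF m(1)] by linarith
      show "norm (kernel m y) \<le> 1 / (T ^ N m - 1)" if "y \<in> K" for y
      proof -
        have "T \<le> norm (w y)" using that S by (simp add: K_def w_def norm_divide pos_le_divide_eq)
        then have "T ^ N m \<le> norm (w y ^ N m)" using T by (simp add: norm_power power_mono)
        then have "T ^ N m - 1 \<le> norm (1 - w y ^ N m)"
          using norm_triangle_ineq2[of "w y ^ N m" 1] by (simp add: norm_minus_commute)
        moreover have "1 < T ^ N m" using T N by (simp add: one_less_power)
        ultimately show ?thesis unfolding kern norm_divide by (simp add: frac_le)
      qed
      have "norm (w x) \<le> 1" using x(1) S by (simp add: w_def norm_divide)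
      then have "norm (1 - w x ^ N m) \<le> 2"
        using norm_triangle_ineq4[of 1 "w x ^ N m"] power_le_one[of "norm (w x)" "N m"] by (simp add: norm_power)
      moreover have "1 - w x ^ N m \<noteq> 0" using kernel_pole[OF x(2), of m] by (simp add: w_def m)
      ultimately show "1 / 2 \<le> norm (kernel m x)" unfolding kern norm_divide by (simp add: frac_le)
    qed
  qed (auto simp: K_def)
  then have "AE y in \<mu>. y \<notin> K" using K by (intro AE_not_in) (simp add: emeasure_eq_measure null_sets_def)
  then show ?thesis using AE_space by eventually_elim (auto simp: K_def sp)
qed

text \<open>The complementary function is -w^N/(1 - w^N), at most 1/(2^N - 1) where |w| \<le> 1/2
  and at least 1/2 where |w| \<ge> 1. Half the radius is enough, as the circles used later have the
  point in question within a quarter of the radius of their centre.\<close>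

lemma null_inside_circle:
  assumes J: "jensen_measure cheese x \<mu>" and x: "S \<le> norm (x - Q)" "x \<in> cheese" and QS: "recurrent Q S"
  shows "AE y in \<mu>. S / 2 < norm (y - Q)"
proof -
  interpret prob_space \<mu> using J by (simp add: jensen_measure_def)
  have sp: "space \<mu> = cheese" using J by (simp add: jensen_measure_def)
  define K where "K = {y \<in> cheese. y \<in> {y. norm (y - Q) \<le> S / 2}}"
  have K: "K \<in> sets \<mu>"
    unfolding K_def by (intro closed_Int_in_sets_jensen[OF J] closed_Collect_le continuous_intros)
  have "measure \<mu> K = 0"
  proof (rule jensen_null_set[OF J K, of 2])
    fix n
    obtain m where m: "n \<le> m" "q m = Q" "s m = S" using QS unfolding recurrent_def by blast
    have S: "0 < S" using s_pos[of m] m by simp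
    have N: "0 < N m" using N2[of m] by simp
    define w where "w y = (y - Q) / S" for y :: complex
    have kern: "1 - kernel m y = - (w y ^ N m) / (1 - w y ^ N m)" if "y \<in> cheese" for y
      using kernel_pole[OF that, of m] by (simp add: kernel_def w_def m field_simps)
    show "\<exists>f\<in>R_alg cheese. \<exists>M\<ge>n. (\<forall>y\<in>cheese. norm (f y) \<le> exp (3 + real M / (real n + 1))) \<and>
        (\<forall>y\<in>K. norm (f y) \<le> 1 / (2 ^ M - 1)) \<and> 1 / 2 \<le> norm (f x)"
    proof (intro bexI[of _ "\<lambda>z. 1 - kernel m z"] exI[of _ "N m"] conjI ballI)
      show "(\<lambda>z. 1 - kernel m z) \<in> R_alg cheese" using kernel_rational rational_on_imp_R_alg by blast
      show "n \<le> N m" using N_ge[of m] m by simp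
      show "norm (1 - kernel m y) \<le> exp (3 + real (N m) / (real n + 1))" if "y \<in> cheese" for y
        using kernel_bound[OF that, of m] four_exp_le[OF m(1)] norm_triangle_ineq4[of 1 "kernel m y"] by simp
      show "norm (1 - kernel m y) \<le> 1 / (2 ^ N m - 1)" if y: "y \<in> K" for y
      proof -
        have "norm (w y) \<le> 1 / 2" using that S by (simp add: K_def w_def norm_divide field_simps)
        then have le: "norm (w y) ^ N m \<le> (1 / 2) ^ N m" by (intro power_mono) auto
        have "1 - norm (w y) ^ N m \<le> norm (1 - w y ^ N m)"
          using norm_triangle_ineq2[of 1 "w y ^ N m"] by (simp add: norm_power)
        then have "1 - (1 / 2) ^ N m \<le> norm (1 - w y ^ N m)" using le by linarith
        moreover have "(1 / 2) ^ N m < (1::real)" using N by (simp add: power_less_one_iff)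
        ultimately have "norm (w y) ^ N m / norm (1 - w y ^ N m) \<le> (1 / 2) ^ N m / (1 - (1 / 2) ^ N m)"
          using le by (intro frac_le) auto
        also have "\<dots> = 1 / (2 ^ N m - 1)"
          using \<open>(1 / 2) ^ N m < (1::real)\<close> by (simp add: power_divide field_simps)
        finally show ?thesis using y by (simp add: kern K_def norm_divide norm_power)
      qed
      have 1: "1 \<le> norm (w x)" using x(1) S by (simp add: w_def norm_divide)
      then have ge: "1 \<le> norm (w x) ^ N m" by (simp add: one_le_power)
      have "norm (1 - w x ^ N m) \<le> 1 + norm (w x) ^ N m"
        using norm_triangle_ineq4[of 1 "w x ^ N m"] by (simp add: norm_power)
      then have "norm (1 - w x ^ N m) \<le> 2 * norm (w x) ^ N m" using ge by linarith
      moreover have "0 < norm (1 - w x ^ N m)" using kernel_pole[OF x(2), of m] by (simp add: w_def m)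
      ultimately show "1 / 2 \<le> norm (1 - kernel m x)"
        by (simp add: kern[OF x(2)] norm_divide norm_power pos_le_divide_eq)
    qed
  qed (auto simp: K_def)
  then have "AE y in \<mu>. y \<notin> K" using K by (intro AE_not_in) (simp add: emeasure_eq_measure null_sets_def)
  then show ?thesis using AE_space by eventually_elim (auto simp: K_def sp)
qed

lemma segment_distance:
  assumes "x \<notin> complex_of_real ` {0..1}"
  obtains \<tau> where "0 < \<tau>" "\<And>t. t \<in> {0..1} \<Longrightarrow> \<tau> \<le> norm (x - complex_of_real t)"
proof -
  have "compact (complex_of_real ` {0..1})" by (intro compact_continuous_image continuous_intros) auto
  then have "open (- complex_of_real ` {0..1})" by (intro open_Compl compact_imp_closed)
  then obtain \<tau> where \<tau>: "0 < \<tau>" "ball x \<tau> \<subseteq> - complex_of_real ` {0..1}" using assms by (meson ComplI openE)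
  have "\<tau> \<le> norm (x - complex_of_real t)" if "t \<in> {0..1}" for t
  proof (rule ccontr)
    assume "\<not> ?thesis"
    then have "complex_of_real t \<in> ball x \<tau>" by (simp add: dist_norm)
    then show False using \<tau>(2) that by blast
  qed
  with \<tau>(1) that show ?thesis by blast
qed

lemma no_jensen: "no_nontrivial_jensen cheese"
  unfolding no_nontrivial_jensen_def
proof (intro ballI allI impI)
  fix x \<mu> assume x: "x \<in> cheese" and J: "jensen_measure cheese x \<mu>"
  interpret prob_space \<mu> using J by (simp add: jensen_measure_def)
  have sp: "space \<mu> = cheese" using J by (simp add: jensen_measure_def)
  have norm2: "norm y \<le> 2" if "y \<in> cheese" for y using that by (simp add: cheese_def)
  \<comment> \<open>A polynomial peaking at x gives \<open>jensen_estimate\<close> with a = e = 0,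
    hence b \<mu>(K) \<le> 0 for the points at distance at least \<epsilon>.\<close>
  have peak: "AE y in \<mu>. norm (y - x) < \<epsilon>"
    if \<epsilon>: "0 < \<epsilon>" and p: "poly p x = 1" "AE y in \<mu>. norm (poly p y) \<le> 1" "0 < b"
      "AE y in \<mu>. \<epsilon> \<le> norm (y - x) \<longrightarrow> norm (poly p y) \<le> exp (- b)" for p \<epsilon> b
  proof -
    define K where "K = {y \<in> cheese. y \<in> {y. \<epsilon> \<le> norm (y - x)}}"
    have K: "K \<in> sets \<mu>"
      unfolding K_def by (intro closed_Int_in_sets_jensen[OF J] closed_Collect_le continuous_intros)
    have "AE y in \<mu>. y \<in> K \<longrightarrow> norm (poly p y) \<le> exp (- b)" using p(4) by eventually_elim (auto simp: K_def)
    then have "b * measure \<mu> K \<le> 0 + 0"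
      using p by (intro jensen_estimate[OF J poly_in_R_alg[of p] K]) auto
    then have "measure \<mu> K = 0" using p(3) measure_nonneg[of \<mu> K] by (simp add: mult_le_0_iff)
    then have "AE y in \<mu>. y \<notin> K" using K by (intro AE_not_in) (simp add: emeasure_eq_measure null_sets_def)
    then show ?thesis using AE_space by eventually_elim (auto simp: K_def sp)
  qed
  have "AE y in \<mu>. norm (y - x) < \<epsilon>" if \<epsilon>: "0 < \<epsilon>" for \<epsilon>
  proof -
    \<comment> \<open>Points of norm 2 are enclosed by no admissible circle and points of the
      segment by no small one; both kinds are reached through peaking polynomials.\<close>
    consider "norm x = 2" | "norm x < 2" "x \<notin> complex_of_real ` {0..1}" | "x \<in> complex_of_real ` {0..1}"
      using norm2[OF x] by fastforce
    then show ?thesis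
    proof cases
      case 1
      \<comment> \<open>This is (1 + u)/2 with u = y * cnj x / 4, which maps the disc of radius 2
        into the unit disc and x to 1. The parallelogram identity for 1 + u and 1 - u shows that it
        peaks at x.\<close>
      define p where "p = [:1/2, cnj x / 8:]"
      have p: "poly p y = (1 + y * cnj x / 4) / 2" for y by (simp add: p_def field_simps)
      have sq: "(norm (poly p y))\<^sup>2 \<le> 1 - (norm (y - x))\<^sup>2 / 16" if "norm y \<le> 2" for y
      proof -
        have xx: "x * cnj x = 4" using 1 complex_norm_square[of x] by simp
        define u where "u = y * cnj x / 4"
        have "norm u \<le> 1" using that 1 by (simp add: u_def norm_mult norm_divide)
        then have "(norm u)\<^sup>2 \<le> 1" by (simp add: power_le_one)
        have "1 - u = (x - y) * cnj x / 4" using xx by (simp add: u_def field_simps)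
        then have "norm (1 - u) = norm ((x - y) * cnj x / 4)" by (rule arg_cong)
        also have "\<dots> = norm (y - x) / 2" using 1 by (simp add: norm_mult norm_divide norm_minus_commute)
        finally have eq: "norm (1 - u) = norm (y - x) / 2" .
        have "(norm (1 - u))\<^sup>2 = (norm (y - x))\<^sup>2 / 4" unfolding eq by (simp add: power_divide)
        moreover have "(norm (1 + u))\<^sup>2 + (norm (1 - u))\<^sup>2 = 2 + 2 * (norm u)\<^sup>2"
          by (simp add: cmod_power2) (simp add: power2_eq_square algebra_simps)
        ultimately have "(norm (1 + u))\<^sup>2 \<le> 4 - (norm (y - x))\<^sup>2 / 4"
          using \<open>(norm u)\<^sup>2 \<le> 1\<close> by linarith
        moreover have eq': "norm (poly p y) = norm (1 + u) / 2" by (simp add: p u_def norm_divide)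
        ultimately show ?thesis unfolding eq' power_divide by simp
      qed
      show ?thesis
      proof (rule peak[OF \<epsilon>])
        show "poly p x = 1" using 1 complex_norm_square[of x] by (simp add: p)
        show "0 < \<epsilon>\<^sup>2 / 32" using \<epsilon> by simp
        have le1: "norm (poly p y) \<le> 1" if "y \<in> cheese" for y
        proof -
          have "(norm (poly p y))\<^sup>2 \<le> 1\<^sup>2" using sq[OF norm2[OF that]] by (simp add: order_trans[OF sq[OF norm2[OF that]]])
          then show ?thesis by (rule power2_le_imp_le) simp
        qed
        show "AE y in \<mu>. norm (poly p y) \<le> 1" using AE_space by eventually_elim (simp add: sp le1)
        have far: "norm (poly p y) \<le> exp (- (\<epsilon>\<^sup>2 / 32))" if "y \<in> cheese" "\<epsilon> \<le> norm (y - x)" for y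
        proof -
          have "(norm (poly p y))\<^sup>2 \<le> 1 - (norm (y - x))\<^sup>2 / 16" using sq norm2 that by blast
          also have "\<dots> \<le> 1 + - (\<epsilon>\<^sup>2 / 16)" using \<epsilon> that(2) by (simp add: power_mono)
          also have "\<dots> \<le> exp (- (\<epsilon>\<^sup>2 / 16))" by (rule exp_ge_add_one_self)
          also have "\<dots> = (exp (- (\<epsilon>\<^sup>2 / 32)))\<^sup>2" by (simp flip: exp_of_nat_mult)
          finally show ?thesis by (rule power2_le_imp_le) simp
        qed
        show "AE y in \<mu>. \<epsilon> \<le> norm (y - x) \<longrightarrow> norm (poly p y) \<le> exp (- (\<epsilon>\<^sup>2 / 32))"
          using AE_space by eventually_elim (use far in \<open>simp add: sp\<close>)
      qed
    next
      case 2
      obtain \<tau> where \<tau>: "0 < \<tau>" "\<And>t. t \<in> {0..1} \<Longrightarrow> \<tau> \<le> norm (x - complex_of_real t)"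
        using segment_distance[OF 2(2)] by blast
      define \<sigma> where "\<sigma> = min \<epsilon> (min \<tau> (2 - norm x))"
      have \<sigma>: "0 < \<sigma>" "\<sigma> \<le> \<epsilon>" "\<sigma> \<le> \<tau>" "norm x + \<sigma> \<le> 2" using \<epsilon> \<tau>(1) 2(1) by (auto simp: \<sigma>_def)
      have "\<sigma> \<le> norm (x - complex_of_real t)" if "t \<in> {0..1}" for t using \<tau>(2)[OF that] \<sigma>(3) by linarith
      then obtain Q S where QS: "norm (Q - x) < \<sigma> / 16" "\<sigma> / 4 < S" "S < \<sigma> / 3" "recurrent Q S"
        using small_circle[OF \<sigma>(1,4)] unfolding recurrent_def by blast
      \<comment> \<open>Any factor above 1 would do here; 2 is small enough because 2S + \<sigma>/16
        < \<sigma> \<le> \<epsilon>.\<close>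
      have "AE y in \<mu>. norm (y - Q) < 2 * S"
        using QS \<sigma> by (intro null_outside_circle[OF J _ x QS(4)]) (auto simp: norm_minus_commute)
      then show ?thesis
      proof eventually_elim
        case (elim y)
        then show ?case using QS \<sigma> norm_triangle_ineq[of "y - Q" "Q - x"] by simp
      qed
    next
      case 3
      then obtain a where a: "a \<in> {0..1}" "x = complex_of_real a" by blast
      \<comment> \<open>The product is 7/4, which leaves a margin of 1/4 to the outer circle; hence
        the cap on \<sigma> below.\<close>
      have big: "AE y in \<mu>. norm (y - 0) < 7 / 6 * (3 / 2)"
        using big_circle a by (intro null_outside_circle[OF J _ x]) (auto simp: recurrent_def)
      \<comment> \<open>Indexing the circles by stages makes the family countable, so a single null
        set serves all of them. Any remaining y off the segment would lie deep inside a small circle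
        with x outside.\<close>
      have "AE y in \<mu>. \<forall>m. recurrent (q m) (s m) \<longrightarrow> s m \<le> norm (x - q m) \<longrightarrow> s m / 2 < norm (y - q m)"
        unfolding AE_all_countable
      proof
        fix m
        show "AE y in \<mu>. recurrent (q m) (s m) \<longrightarrow> s m \<le> norm (x - q m) \<longrightarrow> s m / 2 < norm (y - q m)"
          using null_inside_circle[OF J _ x, of "s m" "q m"] by (cases "recurrent (q m) (s m) \<and> s m \<le> norm (x - q m)") auto
      qed
      then have I: "AE y in \<mu>. y \<in> complex_of_real ` {0..1}"
        using big
      proof eventually_elim
        case (elim y)
        show ?case
        proof (rule ccontr)
          assume "y \<notin> complex_of_real ` {0..1}"
          then obtain \<tau> where \<tau>: "0 < \<tau>" "\<And>t. t \<in> {0..1} \<Longrightarrow> \<tau> \<le> norm (y - complex_of_real t)"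
            using segment_distance by blast
          define \<sigma> where "\<sigma> = min \<tau> (1/4)"
          have \<sigma>: "0 < \<sigma>" "\<sigma> \<le> \<tau>" "norm y + \<sigma> \<le> 2" using \<tau>(1) elim(2) by (auto simp: \<sigma>_def)
          have \<sigma>_le: "\<sigma> \<le> norm (y - complex_of_real t)" if "t \<in> {0..1}" for t using \<tau>(2)[OF that] \<sigma>(2) by linarith
          obtain Q S where QS: "norm (Q - y) < \<sigma> / 16" "\<sigma> / 4 < S" "S < \<sigma> / 3" "recurrent Q S"
            using small_circle[OF \<sigma>(1,3) \<sigma>_le] unfolding recurrent_def by blast
          then obtain m where m: "q m = Q" "s m = S" unfolding recurrent_def by blast
          have "\<sigma> \<le> norm (x - y)" using \<sigma>_le[OF a(1)] a(2) by (simp add: norm_minus_commute)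
          moreover have "norm (x - y) \<le> norm (x - Q) + norm (Q - y)"
            using norm_triangle_ineq[of "x - Q" "Q - y"] by simp
          ultimately have "S \<le> norm (x - Q)" using QS by linarith
          then have "S / 2 < norm (y - Q)" using elim(1) m QS(4) by auto
          then show False using QS by (simp add: norm_minus_commute)
        qed
      qed
      \<comment> \<open>On the segment (y - x)^2 is real and between 0 and 1, so p = 1 - (y - x)^2/2
        peaks at x there. Elsewhere p may exceed 1 in norm, which is why the measure has to be
        confined to the segment first.\<close>
      define p where "p = [:1 - x\<^sup>2 / 2, x, - 1 / 2:]"
      have p: "poly p y = 1 - (y - x)\<^sup>2 / 2" for y by (simp add: p_def field_simps power2_eq_square)
      have pI: "norm (poly p y) = 1 - (norm (y - x))\<^sup>2 / 2" if "y \<in> complex_of_real ` {0..1}" for y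
      proof -
        have "\<exists>t\<in>{0..1}. y = complex_of_real t" using that by blast
        then obtain t where t: "t \<in> {0..1}" "y = complex_of_real t" by blast
        have "\<bar>t - a\<bar> \<le> 1" using t a by auto
        then have "(t - a)\<^sup>2 \<le> 1" by (simp add: abs_square_le_1)
        have "poly p y = complex_of_real (1 - (t - a)\<^sup>2 / 2)" by (simp add: p t a)
        then have "norm (poly p y) = 1 - (t - a)\<^sup>2 / 2" using \<open>(t - a)\<^sup>2 \<le> 1\<close> by (simp only: norm_of_real)
        moreover have "norm (y - x) = \<bar>t - a\<bar>" by (simp add: t a flip: of_real_diff)
        ultimately show ?thesis by simp
      qed
      show ?thesis
      proof (rule peak[OF \<epsilon>])
        show "poly p x = 1" by (simp add: p)
        show "AE y in \<mu>. norm (poly p y) \<le> 1" using I by eventually_elim (simp add: pI)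
        show "0 < \<epsilon>\<^sup>2 / 2" using \<epsilon> by simp
        show "AE y in \<mu>. \<epsilon> \<le> norm (y - x) \<longrightarrow> norm (poly p y) \<le> exp (- (\<epsilon>\<^sup>2 / 2))"
          using I
        proof eventually_elim
          case (elim y)
          show ?case
          proof
            assume "\<epsilon> \<le> norm (y - x)"
            then have "\<epsilon>\<^sup>2 \<le> (norm (y - x))\<^sup>2" using \<epsilon> by (intro power_mono) auto
            then have "norm (poly p y) \<le> 1 + - (\<epsilon>\<^sup>2 / 2)" using pI[OF elim] by simp
            also have "\<dots> \<le> exp (- (\<epsilon>\<^sup>2 / 2))" by (rule exp_ge_add_one_self)
            finally show "norm (poly p y) \<le> exp (- (\<epsilon>\<^sup>2 / 2))" .
          qed
        qed
      qed
    qed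
  qed
  then show "\<mu> = return (restrict_space borel cheese) x" by (rule jensen_eq_return[OF J x])
qed

end


theorem corollary4p12:
  shows "\<exists>X :: complex set. compact_plane_set X \<and> locally connected X \<and>
    R_essential X \<and> R_nontrivial X \<and> \<not> R_regular X \<and> no_nontrivial_jensen X"
proof -
  obtain q :: "nat \<Rightarrow> complex" and s \<delta> :: "nat \<Rightarrow> real" where
    adm: "\<And>m. admissible (q m) (s m) (\<delta> m)"
    and big: "\<And>n. \<exists>m\<ge>n. q m = 0 \<and> s m = 3 / 2"
    and small: "\<And>x \<epsilon>. 0 < \<epsilon> \<Longrightarrow> norm x + \<epsilon> \<le> 2 \<Longrightarrow> (\<And>t. t \<in> {0..1} \<Longrightarrow> \<epsilon> \<le> norm (x - complex_of_real t)) \<Longrightarrow>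
      \<exists>Q S. norm (Q - x) < \<epsilon> / 16 \<and> \<epsilon> / 4 < S \<and> S < \<epsilon> / 3 \<and> (\<forall>n. \<exists>m\<ge>n. q m = Q \<and> s m = S)"
    by (rule admissible_sequence, rule that, assumption, assumption, blast)
  have \<delta>_pos: "0 < \<delta> m" and s_pos: "0 < s m" for m using adm[of m] by (auto simp: admissible_def)
  \<comment> \<open>The circles are fixed by now; d depends on their margins, \<eta> on d, and the
    numbers of points on \<eta>.\<close>
  define d where "d n = min (1/2) (Min ((\<lambda>i. \<delta> i / 4) ` {..n}))" for n :: nat
  have d: "0 < d n" "d n \<le> 1/2" for n
    using \<delta>_pos by (auto simp: d_def)
  have d_le: "d n \<le> \<delta> i / 4" if "i \<le> n" for i n
    unfolding d_def using that by (intro min.coboundedI2 Min_le) auto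
  have "\<exists>\<eta>. propagates (d n) (1 / (real n + 1)) \<eta>" for n
    using d(1) by (intro propagates_ex) auto
  then obtain \<eta>' where \<eta>': "\<And>n. propagates (d n) (1 / (real n + 1)) (\<eta>' n)" by metis
  \<comment> \<open>Decreasing \<eta> strengthens the hypothesis of \<open>propagates\<close>, so
    the cap is harmless.\<close>
  define \<eta> where "\<eta> n = min (\<eta>' n) (1 / (real n + 1))" for n :: nat
  have \<eta>: "propagates (d n) (1 / (real n + 1)) (\<eta> n)" "\<eta> n \<le> 1 / (real n + 1)" for n
    using \<eta>'[of n] by (auto simp: propagates_def \<eta>_def)
  have \<eta>_pos: "0 < \<eta> n" for n using \<eta>(1)[of n] by (simp add: propagates_def)
  define \<mu> where "\<mu> m = Min (insert 1 (\<eta> ` {..<m}))" for m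
  have \<mu>: "0 < \<mu> m" "\<mu> m \<le> 1" "\<And>n. n < m \<Longrightarrow> \<mu> m \<le> \<eta> n" for m
    using \<eta>_pos by (auto simp: \<mu>_def intro!: Min_le)
  \<comment> \<open>One budget for three smallness conditions: s/4 separates the poles of a stage,
    the factor \<open>\<mu> m\<close> \<le> 1 retains the geometric bound on the total radius, and
    \<open>\<mu> m\<close> \<le> \<open>\<eta> n\<close> for n < m makes stage m negligible for
    every earlier unique continuation estimate.\<close>
  define \<beta> where "\<beta> m = min (s m / 4) (\<delta> m / 4 * (1/2) ^ Suc m * \<mu> m)" for m
  have "0 < \<beta> m" for m using s_pos \<delta>_pos \<mu>(1) by (simp add: \<beta>_def)
  then obtain N :: "nat \<Rightarrow> nat" where N: "\<And>m. 2 \<le> N m" "\<And>m. m \<le> N m"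
    "\<And>m. real (N m) * exp (- real (N m) / (real m + 1)) \<le> \<beta> m"
    "\<And>m. 32 * real (N m) * (real (N (Suc m)) * exp (- real (N (Suc m)) / (real (Suc m) + 1))) \<le> exp (- real (N m) / (real m + 1))"
    by (rule rapidly_decreasing_sequence) (rule that)
  define \<rho> where "\<rho> = radius_bound N"
  define pole where "pole = (\<lambda>m j. q m + of_real (s m) * cis (2 * pi * real j / real (N m)))"
  have "\<exists>R\<in>{\<rho> m / 2..\<rho> m}. \<forall>m'>m. \<forall>j<N m. \<forall>j'<N m'. 2 * \<rho> m' \<le> \<bar>norm (pole m' j' - pole m j) - R\<bar>" for m
  proof (rule generic_radius)
    show "1 \<le> N m" for m using N(1)[of m] by simp
  qed (use N(4) in \<open>simp_all add: \<rho>_def radius_bound_def\<close>)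
  then obtain R where R: "\<And>m. R m \<in> {\<rho> m / 2..\<rho> m}"
    "\<And>m m' j j'. m < m' \<Longrightarrow> j < N m \<Longrightarrow> j' < N m' \<Longrightarrow> 2 * \<rho> m' \<le> \<bar>norm (pole m' j' - pole m j) - R m\<bar>"
    by metis
  have \<beta>_s: "real (N m) * \<rho> m \<le> s m / 4" and \<beta>_\<delta>: "real (N m) * \<rho> m \<le> \<delta> m / 4 * (1/2) ^ Suc m * \<mu> m" for m
    using N(3)[of m] by (auto simp: \<rho>_def radius_bound_def \<beta>_def)
  have scale: "0 \<le> \<delta> m / 4 * (1/2) ^ Suc m" for m using \<delta>_pos[of m] by simp
  interpret root_discs_dense q s \<delta> N R d \<eta> pole \<rho>
  proof
    show "real (N m) * \<rho> m \<le> \<delta> m / 4 * (1/2) ^ Suc m" for m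
      using \<beta>_\<delta>[of m] mult_left_mono[OF \<mu>(2)[of m] scale[of m]] by simp
    show "real (N m) * \<rho> m \<le> \<delta> m / 2 * (1/2) ^ Suc m * \<eta> n" if "n < m" for m n
    proof -
      have "\<delta> m / 4 * (1/2) ^ Suc m * \<mu> m \<le> \<delta> m / 4 * (1/2) ^ Suc m * \<eta> n"
        using \<mu>(3)[OF that] scale by (intro mult_left_mono)
      also have "\<dots> \<le> \<delta> m / 2 * (1/2) ^ Suc m * \<eta> n"
        using \<delta>_pos[of m] \<eta>_pos[of n] by (intro mult_right_mono) auto
      finally show ?thesis using \<beta>_\<delta>[of m] by linarith
    qed
  qed (use adm N R \<beta>_s d d_le \<eta> big small in \<open>auto simp: pole_def \<rho>_def\<close>)
  have "compact_plane_set cheese"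
    using compact_cheese segment_subset_cheese[of 0] by (auto simp: compact_plane_set_def)
  then show ?thesis
    using locally_connected_cheese essential not_R_regular no_jensen
    by (intro exI[of _ cheese]) (simp add: compact_plane_set_def R_essential_imp_nontrivial)
qed

end
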